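(* Let $q=(q_n)_{n\in\mathbb N}$ be a probability distribution on $\mathbb N$ with $q_0+q_1=0$, whose support is included in $2\mathbb N+1$, and such that $\mathbb E[N^2]=\sum_n n^2q_n<\infty$, where $N$ has law $q$. Consider the Galton–Watson tree with offspring distribution $q$. For every $k\ge2$ and every $\mathbf p\in\mathscr P_k$ such that $\mathbf p_1=\mathbf p_2>\mathbf p_3\ge\dots\ge\mathbf p_k$ and $\mathbf p_1<\frac12$, the sequence $\mathbf p(m)$ converges, as $m\to\infty$, to $\left(\alpha,\frac{1-\alpha}{2},\frac{1-\alpha}{2},0_{k-2}\right)$, where $\alpha$ is the unique fixed point in $(0,1)$ of $$f:t\in[0,1]\longmapsto\sum_{n\ge1}q_{2n+1}f_{2n+1}(t).$$ If instead $\mathbf p_1=\mathbf p_2=\frac12$, then $\mathbf p(m)=\left(0,\frac12,\frac12,0_{k-2}\right)$ for every $m\ge0$.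
   Context: $\mathscr P_k:=\{\mathbf p=(\mathbf p_0,\dots,\mathbf p_k)\in(\mathbb R_+)^{k+1}:\sum_{i=0}^k\mathbf p_i=1,\ \mathbf p_0<1\}$. $0_{r}$ denotes $r$ zero coordinates (for $k=2$ the condition on $\mathbf p_3,\dots,\mathbf p_k$ is void). For $n\ge1$ and $t\in[0,1]$, $f_n(t)=\sum_{j,\,0\le2j\le n}\binom{n}{2j}\binom{2j}{j}\left(\frac{1-t}{2}\right)^{2j}t^{n-2j}$. Opinion model on the Galton–Watson tree cut at height $m$: each node of generation $<m$ has a random number of children with law $q$, independently. Independently, each leaf (node of generation $m$) has opinion $i\in\{1,\dots,k\}$ with probability $\mathbf p_i$ and is undecided with probability $\mathbf p_0$. Opinions propagate from children to parent: undecided children have no influence, except that if all children are undecided then the parent is undecided; if one opinion is held by strictly more children than every other opinion, the parent takes this opinion; if several opinions are tied for the largest number of children, the parent is undecided. $\mathbf p(m)=(\mathbf p_0(m),\dots,\mathbf p_k(m))$ is the law of the state of the root: $\mathbf p_i(m)=\mathbb P(\text{root thinks }i)$ for $1\le i\le k$, $\mathbf p_0(m)=\mathbb P(\text{root undecided})$. Equivalently, $\mathbf p(0)=\mathbf p$ and $\mathbf p(m)=H(\mathbf p(m-1))$ where, for $1\le i\le k$, $$H_i(\mathbf p)=\sum_{n\ge2}q_n\sum_{m_0=0}^{n-1}\binom{n}{m_0}\mathbf p_0^{m_0}\sum_{(m_1,\dots,m_k)\in S^i_{n-m_0}}\binom{n-m_0}{m_1,\dots,m_k}\prod_{j=1}^k\mathbf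 p_j^{m_j},\qquad H_0(\mathbf p)=1-\sum_{j=1}^kH_j(\mathbf p),$$ with $S^i_r=\{(m_1,\dots,m_k)\in\mathbb N^k:\ m_j<m_i\ \forall j\ne i,\ \sum_{j=1}^km_j=r\}$. *)

theory Defs
  imports "HOL-Probability.Probability"
begin

(* States of a node: 0 means undecided, i >= 1 means opinion i.  A probability vector
   (p_0, ..., p_k) is a pmf on nat supported in {0..k}, with p_i = pmf p i. *)

definition prob_vectors :: "nat \<Rightarrow> nat pmf set" where
  "prob_vectors k = {p. set_pmf p \<subseteq> {0..k} \<and> pmf p 0 < 1}"

(* Plane trees of finite height.  Leaf stands for a node of generation m (the cut height) only;
   a childless node of an earlier generation would be Node []. *)

datatype 'a cut_tree = Leaf 'a | Node "'a cut_tree list"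

primrec gw_tree :: "nat pmf \<Rightarrow> nat \<Rightarrow> unit cut_tree pmf" where
  "gw_tree q 0 = return_pmf (Leaf ())"
| "gw_tree q (Suc m) = bind_pmf q (\<lambda>n. map_pmf Node (replicate_pmf n (gw_tree q m)))"

(* Law of a list of independent entries, the i-th one having the i-th given law. *)

primrec indep_list_pmf :: "'a pmf list \<Rightarrow> 'a list pmf" where
  "indep_list_pmf [] = return_pmf []"
| "indep_list_pmf (\<mu> # \<mu>s) =
     bind_pmf \<mu> (\<lambda>x. bind_pmf (indep_list_pmf \<mu>s) (\<lambda>xs. return_pmf (x # xs)))"

(* Given the tree, its leaves receive independent states of law p. *)

primrec leaf_states :: "'a pmf \<Rightarrow> 'b cut_tree \<Rightarrow> 'a cut_tree pmf" where
  "leaf_states p (Leaf u) = map_pmf Leaf p"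
| "leaf_states p (Node ts) = map_pmf Node (indep_list_pmf (map (leaf_states p) ts))"

(* The competitors j range over all opinions j >= 1, not only those up to k; an opinion held by
   nobody thus beats no other one, so that undecided children alone give an undecided parent. *)

definition winner :: "nat list \<Rightarrow> nat \<Rightarrow> bool" where
  "winner xs i \<longleftrightarrow> i \<ge> 1 \<and> (\<forall>j\<ge>1. j \<noteq> i \<longrightarrow> count_list xs j < count_list xs i)"

definition parent_state :: "nat list \<Rightarrow> nat" where
  "parent_state xs = (if \<exists>i. winner xs i then THE i. winner xs i else 0)"

primrec root_state :: "nat cut_tree \<Rightarrow> nat" where
  "root_state (Leaf i) = i"
| "root_state (Node ts) = parent_state (map root_state ts)"

definition root_law :: "nat pmf \<Rightarrow> nat pmf \<Rightarrow> nat \<Rightarrow> nat pmf" where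
  "root_law q p m = map_pmf root_state (bind_pmf (gw_tree q m) (leaf_states p))"

definition f_poly :: "nat \<Rightarrow> real \<Rightarrow> real" where
  "f_poly n t = (\<Sum>j | 2 * j \<le> n. real (n choose (2 * j)) * real ((2 * j) choose j)
                    * ((1 - t) / 2) ^ (2 * j) * t ^ (n - 2 * j))"

definition f_map :: "nat pmf \<Rightarrow> real \<Rightarrow> real" where
  "f_map q t = (\<Sum>\<^sub>\<infinity>n\<in>{1..}. pmf q (2 * n + 1) * f_poly (2 * n + 1) t)"

(* The vector (a, (1 - a)/2, (1 - a)/2, 0, ..., 0). *)

definition two_opinion_vector :: "real \<Rightarrow> nat \<Rightarrow> real" where
  "two_opinion_vector a i = (if i = 0 then a else if i \<in> {1, 2} then (1 - a) / 2 else 0)"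

end

theory Submission
  imports Defs "HOL-Combinatorics.Multiset_Permutations"
begin

text \<open>
  With \<open>m\<close>-th law \<open>P\<close>, the next law is that of the vote of \<open>n\<close> independent voters of law \<open>P\<close>,
  averaged over \<open>n\<close>. Exchanging two opinions in a word of votes shows that the ratio
  \<open>r = P j / P 1\<close>, \<open>j \<ge> 3\<close>, becomes at most \<open>r (1 - c (1 - r))\<close>, where \<open>c\<close> bounds the probability
  of unanimity for opinion \<open>1\<close> from below; such a \<open>c\<close> exists since \<open>P 1\<close> grows whenever it is small.
  Hence the ratios decay geometrically, and the probability of being undecided
  is asymptotically an orbit of \<open>f\<close> with vanishing perturbation.

  For \<open>n\<close> odd, \<open>f\<^sub>n(t)\<close> is the mean of \<open>(t + (1 - t) cos \<theta>)\<^sup>n\<close> over equidistributed angles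
  \<open>\<theta>\<close>, so that \<open>f\<close> is increasing and \<open>f(t) / t\<close> is convex. Since \<open>f(t) > t\<close> near \<open>0\<close>, \<open>f(t) < t\<close>
  just below \<open>1\<close> and \<open>f(1) = 1\<close>, there is exactly one fixed point \<open>\<alpha>\<close> in \<open>(0, 1)\<close> and it attracts
  every perturbed orbit that stays away from \<open>0\<close> and \<open>1\<close>. Staying away from \<open>0\<close> follows as
  a single child outside \<open>{1, 2}\<close> facing a balanced vote of the others makes the parent undecided.
\<close>

subsection \<open>The polynomials $f_n$ for odd $n$\<close>

text \<open>A geometric sum of powers of a root of unity \<open>w\<close>; the bound on
  \<open>d\<close> excludes \<open>w = 1\<close> unless \<open>d = 0\<close>.\<close>

lemma sum_cis_roots:
  fixes d :: int
  assumes "\<bar>d\<bar> < int M"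
  shows "(\<Sum>l<M. cis (of_int d * (2 * pi * real l / real M))) = (if d = 0 then of_nat M else 0)"
proof (cases "d = 0")
  case False
  have M: "M > 0" using assms by linarith
  define w where "w = cis (of_int d * (2 * pi / real M))"
  have pow: "cis (of_int d * (2 * pi * real l / real M)) = w ^ l" for l
    unfolding w_def Complex.DeMoivre by (rule arg_cong[where f = cis]) simp
  have "w ^ M = cis (2 * pi * of_int d)"
    using M by (simp add: w_def Complex.DeMoivre algebra_simps)
  then have wM: "w ^ M = 1" by (simp add: complex_eq_iff)
  have "w \<noteq> 1"
  proof
    assume "w = 1"
    then have "cos (of_int d * (2 * pi / real M)) = 1" by (simp add: w_def complex_eq_iff)
    then obtain n :: int where n: "of_int d * (2 * pi / real M) = of_int n * 2 * pi"
      using cos_one_2pi_int by auto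
    have "of_int d = (of_int n * real M :: real)"
      using n M by (simp add: field_simps)
    then have dn: "d = n * int M" by (metis of_int_eq_iff of_int_mult of_int_of_nat_eq)
    with False have "\<bar>n\<bar> \<ge> 1" by auto
    then have "int M \<le> \<bar>n\<bar> * int M" by (simp add: mult_le_cancel_right1)
    with dn assms show False by (simp add: abs_mult)
  qed
  then have "(\<Sum>l<M. w ^ l) = 0" using wM by (simp add: geometric_sum)
  with False show ?thesis by (simp only: pow if_False)
qed simp

text \<open>Expanding the cosine by Euler's formula leaves the frequencies \<open>2 * a - i\<close>.
  They lie strictly between \<open>- M\<close> and \<open>M\<close>, so only the frequency 0
  survives the summation.\<close>

lemma sum_cos_power_roots:
  assumes "i < M"
  shows "(\<Sum>l<M. cos (2 * pi * real l / real M) ^ i)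
    = real M * (if even i then real (i choose (i div 2)) / 2 ^ i else 0)"
proof -
  have cos_pow: "of_real (cos \<theta> ^ i)
      = (\<Sum>a\<le>i. of_nat (i choose a) * cis (of_int (2 * int a - int i) * \<theta>)) / (2 ^ i :: complex)" for \<theta>
  proof -
    have half: "of_real (cos \<theta>) = (cis \<theta> + cis (- \<theta>)) / 2" by (simp add: complex_eq_iff)
    have "of_real (cos \<theta> ^ i) = (cis \<theta> + cis (- \<theta>)) ^ i / 2 ^ i"
      unfolding of_real_power half power_divide ..
    also have "(cis \<theta> + cis (- \<theta>)) ^ i
        = (\<Sum>a\<le>i. of_nat (i choose a) * cis (of_int (2 * int a - int i) * \<theta>))"
      unfolding binomial_ring
    proof (rule sum.cong)
      fix a assume "a \<in> {..i}"
      then have "real a * \<theta> + real (i - a) * (- \<theta>) = of_int (2 * int a - int i) * \<theta>"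
        by (simp add: of_nat_diff algebra_simps)
      then have "cis \<theta> ^ a * cis (- \<theta>) ^ (i - a) = cis (of_int (2 * int a - int i) * \<theta>)"
        by (simp only: Complex.DeMoivre cis_mult)
      then show "of_nat (i choose a) * cis \<theta> ^ a * cis (- \<theta>) ^ (i - a)
          = of_nat (i choose a) * cis (of_int (2 * int a - int i) * \<theta>)"
        by (simp only: mult.assoc)
    qed simp
    finally show ?thesis .
  qed
  have "complex_of_real (\<Sum>l<M. cos (2 * pi * real l / real M) ^ i)
      = (\<Sum>l<M. \<Sum>a\<le>i. of_nat (i choose a) * cis (of_int (2 * int a - int i) * (2 * pi * real l / real M))) / 2 ^ i"
    unfolding of_real_sum cos_pow sum_divide_distrib ..
  also have "\<dots> = (\<Sum>a\<le>i. of_nat (i choose a)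
      * (\<Sum>l<M. cis (of_int (2 * int a - int i) * (2 * pi * real l / real M)))) / 2 ^ i"
    by (subst sum.swap) (simp only: sum_distrib_left)
  also have "\<dots> = (\<Sum>a\<le>i. of_nat (i choose a) * (if 2 * a = i then of_nat M else 0)) / 2 ^ i"
  proof -
    have "(\<Sum>l<M. cis (of_int (2 * int a - int i) * (2 * pi * real l / real M)))
        = (if 2 * a = i then of_nat M else 0)" if "a \<le> i" for a
    proof -
      have "\<bar>2 * int a - int i\<bar> < int M" using that assms by linarith
      moreover have "2 * int a - int i = 0 \<longleftrightarrow> 2 * a = i" by linarith
      ultimately show ?thesis by (subst sum_cis_roots) auto
    qed
    then show ?thesis by simp
  qed
  also have "\<dots> = of_real (real M * (if even i then real (i choose (i div 2)) / 2 ^ i else 0))"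
  proof (cases "even i")
    case True
    then obtain b where b: "i = 2 * b" by blast
    have "(\<Sum>a\<le>i. of_nat (i choose a) * (if 2 * a = i then of_nat M else 0))
        = (\<Sum>a\<le>i. if a = b then of_nat (i choose a) * of_nat M else (0::complex))"
      by (intro sum.cong) (auto simp: b)
    then show ?thesis by (simp add: b)
  next
    case False
    then have "(\<Sum>a\<le>i. of_nat (i choose a) * (if 2 * a = i then of_nat M else (0::complex))) = 0"
      by (intro sum.neutral) auto
    with False show ?thesis by simp
  qed
  finally show ?thesis by (simp only: of_real_eq_iff)
qed

lemma sum_even_le:
  fixes g :: "nat \<Rightarrow> 'a::comm_monoid_add"
  shows "(\<Sum>i\<le>n. if even i then g i else 0) = (\<Sum>j | 2 * j \<le> n. g (2 * j))"
proof -
  have "(\<Sum>i\<le>n. if even i then g i else 0) = (\<Sum>i | i \<le> n \<and> even i. g i)"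
    by (subst sum.inter_filter [symmetric]) auto
  also have "{i. i \<le> n \<and> even i} = (\<lambda>j. 2 * j) ` {j. 2 * j \<le> n}" by (auto elim!: evenE)
  also have "sum g \<dots> = (\<Sum>j | 2 * j \<le> n. g (2 * j))"
    by (subst sum.reindex) (auto simp: inj_on_def)
  finally show ?thesis .
qed

text \<open>The moments of the cosine supply (2j choose j) / 4^j in a binomial expansion. The sum
  over \<open>M > n\<close> equidistributed angles replaces an integral: it is exact up to degree
  \<open>n\<close>, and monotonicity and convexity pass through a finite sum directly.\<close>

lemma f_poly_average:
  assumes "n < M"
  shows "f_poly n t = (\<Sum>l<M. (t + (1 - t) * cos (2 * pi * real l / real M)) ^ n) / real M"
proof -
  let ?c = "\<lambda>l. cos (2 * pi * real l / real M)"
  have "(\<Sum>l<M. (t + (1 - t) * ?c l) ^ n)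
      = (\<Sum>l<M. \<Sum>i\<le>n. real (n choose i) * ((1 - t) * ?c l) ^ i * t ^ (n - i))"
    by (subst add.commute) (simp only: binomial_ring)
  also have "\<dots> = (\<Sum>i\<le>n. real (n choose i) * (1 - t) ^ i * t ^ (n - i) * (\<Sum>l<M. ?c l ^ i))"
    by (subst sum.swap) (simp add: sum_distrib_left power_mult_distrib mult_ac)
  also have "\<dots> = (\<Sum>i\<le>n. if even i then real M * (real (n choose i) * (1 - t) ^ i * t ^ (n - i)
      * real (i choose (i div 2)) / 2 ^ i) else 0)"
    using assms by (intro sum.cong) (auto simp: sum_cos_power_roots)
  also have "\<dots> = real M * f_poly n t"
    unfolding sum_even_le f_poly_def sum_distrib_left
    by (intro sum.cong) (auto simp: power_divide power_mult)
  finally show ?thesis using assms by simp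
qed

text \<open>Each base moves up with \<open>t\<close> because \<open>1 - cos x \<ge> 0\<close>; odd
  powers preserve this also for negative bases.\<close>

lemma f_poly_mono:
  assumes "odd n" "s \<le> t"
  shows "f_poly n s \<le> f_poly n t"
proof -
  have "(s + (1 - s) * cos x) ^ n \<le> (t + (1 - t) * cos x) ^ n" for x
  proof (rule power_mono_odd[OF \<open>odd n\<close>])
    have "0 \<le> (t - s) * (1 - cos x)" using assms by simp
    then show "s + (1 - s) * cos x \<le> t + (1 - t) * cos x" by (simp add: algebra_simps)
  qed
  then show ?thesis
    unfolding f_poly_average[OF lessI[of n]] by (intro divide_right_mono sum_mono) auto
qed

text \<open>The second derivative of \<open>h(t) = \<phi>(t) / t\<close> is \<open>(t\<^sup>2 \<phi>'' - 2 t \<phi>' + 2 \<phi>) / t\<^sup>3\<close>; the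
  numerator vanishes at \<open>0\<close> and has derivative \<open>t\<^sup>2 \<phi>'''\<close>, which is nonnegative as \<open>n - 3\<close> is even.\<close>

lemma convex_on_odd_power_quotient:
  fixes c :: real
  assumes "odd n" "c \<le> 1"
  shows "convex_on {0<..} (\<lambda>t. ((c + t * (1 - c)) ^ n - c ^ n) / t)"
proof -
  define D where "D = 1 - c"
  have D: "D \<ge> 0" using assms by (simp add: D_def)
  define \<phi> where "\<phi> = (\<lambda>t. (c + t * D) ^ n - c ^ n)"
  define \<phi>1 where "\<phi>1 = (\<lambda>t. real n * D * (c + t * D) ^ (n - 1))"
  define \<phi>2 where "\<phi>2 = (\<lambda>t. real n * real (n - 1) * D ^ 2 * (c + t * D) ^ (n - 2))"
  define \<phi>3 where "\<phi>3 = (\<lambda>t. real n * real (n - 1) * real (n - 2) * D ^ 3 * (c + t * D) ^ (n - 3))"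
  have d0: "(\<phi> has_real_derivative \<phi>1 t) (at t)" for t
    unfolding \<phi>_def \<phi>1_def by (auto intro!: derivative_eq_intros)
  have d1: "(\<phi>1 has_real_derivative \<phi>2 t) (at t)" for t
    unfolding \<phi>1_def \<phi>2_def
    by (auto intro!: derivative_eq_intros simp: power2_eq_square eval_nat_numeral)
  have d2: "(\<phi>2 has_real_derivative \<phi>3 t) (at t)" for t
    unfolding \<phi>2_def \<phi>3_def
    by (auto intro!: derivative_eq_intros simp: eval_nat_numeral)
  have \<phi>3: "\<phi>3 t \<ge> 0" for t
  proof (cases "n = 1")
    case False
    with \<open>odd n\<close> obtain l where "n = 2 * l + 1" "l \<noteq> 0" by (elim oddE) simp
    then have "even (n - 3)" by simp
    then have "0 \<le> (c + t * D) ^ (n - 3)" by (rule zero_le_even_power)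
    with D show ?thesis unfolding \<phi>3_def
      by (intro mult_nonneg_nonneg[OF _ \<open>0 \<le> (c + t * D) ^ (n - 3)\<close>]) simp
  qed (simp add: \<phi>3_def)
  define N where "N = (\<lambda>t. t\<^sup>2 * \<phi>2 t - 2 * t * \<phi>1 t + 2 * \<phi> t)"
  have dN: "(N has_real_derivative t\<^sup>2 * \<phi>3 t) (at t)" for t
    unfolding N_def by (rule derivative_eq_intros d0 d1 d2 refl)+ (simp add: algebra_simps)
  have N: "N t \<ge> 0" if "t > 0" for t
  proof -
    have "N 0 \<le> N t"
      by (rule DERIV_nonneg_imp_nondecreasing)
         (use that dN \<phi>3 in \<open>auto intro!: exI mult_nonneg_nonneg\<close>)
    then show ?thesis by (simp add: N_def \<phi>_def)
  qed
  have "convex_on {0<..} (\<lambda>t. \<phi> t / t)"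
  proof (rule f''_ge0_imp_convex)
    fix t :: real assume "t \<in> {0<..}"
    then have t: "t > 0" by simp
    show "((\<lambda>t. \<phi> t / t) has_real_derivative (t * \<phi>1 t - \<phi> t) / t\<^sup>2) (at t)"
      using t by (auto intro!: derivative_eq_intros d0 simp: field_simps power2_eq_square)
    have e: "((\<lambda>t. t * \<phi>1 t - \<phi> t) has_real_derivative t * \<phi>2 t) (at t)"
      using DERIV_diff[OF DERIV_mult[OF DERIV_ident d1[of t]] d0[of t]] by (simp add: mult.commute)
    have sq: "((\<lambda>t. t\<^sup>2) has_real_derivative 2 * t) (at t)"
      by (auto intro!: derivative_eq_intros)
    have "(t * \<phi>2 t * t\<^sup>2 - (t * \<phi>1 t - \<phi> t) * (2 * t)) / (t\<^sup>2 * t\<^sup>2) = (t * N t) / (t * t ^ 3)"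
      by (rule arg_cong2[where f = "(/)"])
         (simp_all add: N_def algebra_simps power2_eq_square power3_eq_cube)
    also have "\<dots> = N t / t ^ 3" using t by simp
    finally show "((\<lambda>t. (t * \<phi>1 t - \<phi> t) / t\<^sup>2) has_real_derivative N t / t ^ 3) (at t)"
      using DERIV_divide[OF e sq] t by simp
    show "N t / t ^ 3 \<ge> 0" using t N by simp
  qed simp
  then show ?thesis by (simp add: \<phi>_def D_def)
qed

lemma convex_on_sum_fun:
  assumes "convex S" "\<And>i. i \<in> I \<Longrightarrow> convex_on S (f i)"
  shows "convex_on S (\<lambda>t. \<Sum>i\<in>I. f i t)"
proof (rule convex_onI)
  fix u :: real and x y assume "0 < u" "u < 1" "x \<in> S" "y \<in> S"
  then have "(\<Sum>i\<in>I. f i ((1 - u) *\<^sub>R x + u *\<^sub>R y)) \<le> (\<Sum>i\<in>I. (1 - u) * f i x + u * f i y)"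
    using assms by (intro sum_mono) (auto simp: convex_on_def)
  also have "\<dots> = (1 - u) * (\<Sum>i\<in>I. f i x) + u * (\<Sum>i\<in>I. f i y)"
    by (simp add: sum.distrib sum_distrib_left)
  finally show "(\<Sum>i\<in>I. f i ((1 - u) *\<^sub>R x + u *\<^sub>R y))
      \<le> (1 - u) * (\<Sum>i\<in>I. f i x) + u * (\<Sum>i\<in>I. f i y)" .
qed (fact assms)

text \<open>A single power divided by \<open>t\<close> need not be convex when its base is negative
  at \<open>t = 0\<close>. Since the odd powers \<open>?c l ^ n\<close> sum to zero, they can be
  subtracted, and each numerator then vanishes at 0.\<close>

lemma convex_on_f_poly_quotient:
  assumes "odd n"
  shows "convex_on {0<..} (\<lambda>t. f_poly n t / t)"
proof -
  let ?c = "\<lambda>l. cos (2 * pi * real l / real (Suc n))"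
  have zero: "(\<Sum>l<Suc n. ?c l ^ n) = 0"
    using assms by (subst sum_cos_power_roots) auto
  have "f_poly n t / t
      = (1 / real (Suc n)) * (\<Sum>l<Suc n. ((?c l + t * (1 - ?c l)) ^ n - ?c l ^ n) / t)" for t
  proof -
    have "(\<Sum>l<Suc n. (?c l + t * (1 - ?c l)) ^ n) = (\<Sum>l<Suc n. (t + (1 - t) * ?c l) ^ n)"
      by (intro sum.cong refl arg_cong[where f = "\<lambda>x. x ^ n"]) (simp add: algebra_simps)
    then show ?thesis
      unfolding f_poly_average[OF lessI[of n]] sum_divide_distrib[symmetric] sum_subtractf zero
      by (simp del: sum.lessThan_Suc)
  qed
  moreover have "convex_on {0<..} (\<lambda>t. (1 / real (Suc n))
      * (\<Sum>l<Suc n. ((?c l + t * (1 - ?c l)) ^ n - ?c l ^ n) / t))"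
    by (intro convex_on_cmul convex_on_sum_fun convex_on_odd_power_quotient assms) auto
  ultimately show ?thesis by presburger
qed

section \<open>Bounds on the polynomials over the unit interval\<close>

lemma f_poly_nonneg: "0 \<le> t \<Longrightarrow> t \<le> 1 \<Longrightarrow> 0 \<le> f_poly n t"
  unfolding f_poly_def by (intro sum_nonneg) auto

lemma central_binomial_le: "real ((2 * j) choose j) \<le> 4 ^ j"
proof -
  have "(2 * j) choose j \<le> 2 ^ (2 * j)" by (rule binomial_le_pow2)
  also have "(2::nat) ^ (2 * j) = 4 ^ j" by (simp add: power_mult)
  finally show ?thesis by (metis of_nat_le_iff of_nat_numeral of_nat_power)
qed

text \<open>From \<open>l\<close> to \<open>Suc l\<close> the left side is multiplied by 4 (2l + 3)
  / (2l + 2), hence by more than 4; at \<open>l = 1\<close> equality holds. A constant above 1 is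
  what later gives a slope above 1 at the origin.\<close>

lemma central_binomial_ge:
  assumes "l \<ge> 1"
  shows "real (2 * l + 1) * real ((2 * l) choose l) \<ge> 3 / 2 * 4 ^ l"
  using assms
proof (induction l rule: nat_induct_at_least)
  case base
  then show ?case by (simp add: numeral_2_eq_2)
next
  case (Suc l)
  have "Suc l * (Suc (Suc (2 * l)) choose Suc l) = Suc (Suc (2 * l)) * (Suc (2 * l) choose l)"
    by (rule Suc_times_binomial)
  moreover have "(l + 1) * (Suc (2 * l) choose l) = Suc (2 * l) * (2 * l choose l)"
  proof -
    have "Suc l * (Suc (2 * l) choose Suc l) = Suc (2 * l) * (2 * l choose l)"
      by (rule Suc_times_binomial)
    moreover have "Suc (2 * l) choose Suc l = Suc (2 * l) choose l"
      by (subst binomial_symmetric) auto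
    ultimately show ?thesis by simp
  qed
  ultimately have "(l + 1) * ((l + 1) * (Suc (Suc (2 * l)) choose Suc l))
      = Suc (Suc (2 * l)) * (Suc (2 * l) * (2 * l choose l))"
    by (metis Suc_eq_plus1 mult.left_commute)
  then have eq': "(l + 1) * ((l + 1) * (2 * Suc l choose Suc l))
      = (l + 1) * (2 * (2 * l + 1) * (2 * l choose l))"
    by (simp add: algebra_simps)
  have eq: "(l + 1) * (2 * Suc l choose Suc l) = 2 * (2 * l + 1) * (2 * l choose l)"
    using eq' by (simp only: mult_cancel1) linarith
  define X where "X = real (2 * Suc l choose Suc l)"
  have X: "real (l + 1) * X = 2 * (real (2 * l + 1) * real (2 * l choose l))"
    using arg_cong[OF eq, where f = real]
    by (simp only: X_def of_nat_mult of_nat_numeral mult.assoc)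
  have "3 / 2 * 4 ^ Suc l \<le> 4 * (real (2 * l + 1) * real (2 * l choose l))"
    using Suc.IH by simp
  also have "\<dots> = 2 * (real (l + 1) * X)" by (simp only: X)
  also have "\<dots> = real (2 * l + 2) * X" by (simp add: algebra_simps)
  also have "\<dots> \<le> real (2 * Suc l + 1) * X"
    by (intro mult_right_mono) (auto simp: X_def)
  finally show ?case by (simp only: X_def)
qed

text \<open>Only the summand with \<open>2 * j = n - 1\<close> is kept, the one of first order in
  \<open>t\<close>.\<close>

lemma f_poly_ge:
  assumes "odd n" "n \<ge> 3" "0 \<le> t" "t \<le> 1"
  shows "3 / 2 * t * (1 - t) ^ (n - 1) \<le> f_poly n t"
proof -
  obtain l where l: "n = 2 * l + 1" using \<open>odd n\<close> by (rule oddE)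
  have "l \<ge> 1" using l assms by simp
  have "3 / 2 * t * (1 - t) ^ (n - 1) = (3 / 2 * 4 ^ l) * (((1 - t) / 2) ^ (2 * l) * t)"
    by (simp add: l power_divide power_mult)
  also have "\<dots> \<le> (real (2 * l + 1) * real ((2 * l) choose l)) * (((1 - t) / 2) ^ (2 * l) * t)"
    using central_binomial_ge[OF \<open>l \<ge> 1\<close>] assms by (intro mult_right_mono) auto
  also have "\<dots> = real (n choose (2 * l)) * real ((2 * l) choose l) * ((1 - t) / 2) ^ (2 * l) * t ^ (n - 2 * l)"
    by (simp add: l)
  also have "\<dots> \<le> f_poly n t"
    unfolding f_poly_def
  proof (rule member_le_sum)
    show "finite {j. 2 * j \<le> n}" by (rule finite_subset[of _ "{..n}"]) auto
  qed (use l assms in auto)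
  finally show ?thesis .
qed

text \<open>Bounding the central binomials by \<open>4 ^ j\<close> gives the even part of the
  binomial expansion of \<open>((1 - t) + t) ^ n\<close>. Of the missing odd terms, the one of index
  1 is recorded as a deficit: it decides the behaviour near \<open>t = 1\<close>.\<close>

lemma f_poly_le:
  assumes "n \<ge> 1" "0 \<le> t" "t \<le> 1"
  shows "f_poly n t \<le> 1 - real n * (1 - t) * t ^ (n - 1)"
proof -
  have "f_poly n t \<le> (\<Sum>j | 2 * j \<le> n. real (n choose (2 * j)) * (1 - t) ^ (2 * j) * t ^ (n - 2 * j))"
    unfolding f_poly_def
  proof (rule sum_mono)
    fix j
    have "real ((2 * j) choose j) * ((1 - t) / 2) ^ (2 * j) \<le> 4 ^ j * ((1 - t) / 2) ^ (2 * j)"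
      using central_binomial_le assms by (intro mult_right_mono) auto
    also have "\<dots> = (1 - t) ^ (2 * j)" by (simp add: power_divide power_mult)
    finally have "real (n choose (2 * j)) * (real ((2 * j) choose j) * ((1 - t) / 2) ^ (2 * j)) * t ^ (n - 2 * j)
        \<le> real (n choose (2 * j)) * (1 - t) ^ (2 * j) * t ^ (n - 2 * j)"
      using assms by (intro mult_right_mono mult_left_mono) auto
    then show "real (n choose (2 * j)) * real ((2 * j) choose j) * ((1 - t) / 2) ^ (2 * j) * t ^ (n - 2 * j)
        \<le> real (n choose (2 * j)) * (1 - t) ^ (2 * j) * t ^ (n - 2 * j)"
      by (simp only: mult.assoc)
  qed
  also have "\<dots> = (\<Sum>i\<le>n. if even i then real (n choose i) * (1 - t) ^ i * t ^ (n - i) else 0)"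
    by (rule sum_even_le[symmetric])
  also have "\<dots> \<le> (\<Sum>i\<le>n. real (n choose i) * (1 - t) ^ i * t ^ (n - i)
      - (if i = 1 then real n * (1 - t) * t ^ (n - 1) else 0))"
    using assms by (intro sum_mono) auto
  also have "\<dots> = ((1 - t) + t) ^ n - real n * (1 - t) * t ^ (n - 1)"
    unfolding sum_subtractf binomial_ring using assms(1) by (simp del: diff_add_cancel)
  finally show ?thesis by simp
qed

lemma f_poly_le_1: "0 \<le> t \<Longrightarrow> t \<le> 1 \<Longrightarrow> f_poly n t \<le> 1"
  using f_poly_le[of n t] by (cases "n = 0") (auto simp: f_poly_def intro: order_trans)

subsection \<open>Votes of independent voters\<close>

lemma root_law_0: "root_law q p 0 = p"
  by (simp add: root_law_def bind_return_pmf map_pmf_comp)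

text \<open>The label of the first tree can be drawn before the remaining trees, so a list of random
  trees with independent labellings is a list of independent labelled trees.\<close>

lemma bind_replicate_indep_list_pmf:
  "bind_pmf (replicate_pmf n A) (\<lambda>ts. indep_list_pmf (map L ts)) = replicate_pmf n (bind_pmf A L)"
proof (induction n)
  case (Suc n)
  have "bind_pmf (replicate_pmf (Suc n) A) (\<lambda>ts. indep_list_pmf (map L ts))
      = A \<bind> (\<lambda>t. replicate_pmf n A \<bind> (\<lambda>ts. L t \<bind> (\<lambda>x.
          indep_list_pmf (map L ts) \<bind> (\<lambda>xs. return_pmf (x # xs)))))"
    by (simp add: bind_assoc_pmf bind_return_pmf)
  also have "\<dots> = A \<bind> (\<lambda>t. L t \<bind> (\<lambda>x. replicate_pmf n A \<bind> (\<lambda>ts.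
          indep_list_pmf (map L ts) \<bind> (\<lambda>xs. return_pmf (x # xs)))))"
    by (subst bind_commute_pmf) simp
  also have "\<dots> = replicate_pmf (Suc n) (bind_pmf A L)"
    by (simp add: bind_assoc_pmf Suc.IH[symmetric])
  finally show ?case .
qed (simp add: bind_return_pmf)

lemma map_replicate_pmf: "map_pmf (map f) (replicate_pmf n A) = replicate_pmf n (map_pmf f A)"
proof (induction n)
  case (Suc n)
  then show ?case
    by (simp add: map_bind_pmf bind_map_pmf Suc.IH[symmetric])
qed simp

text \<open>The subtrees at the root, with their leaf states, are independent copies of the model of
  height \<open>m\<close>.\<close>

lemma root_law_Suc:
  "root_law q p (Suc m) = bind_pmf q (\<lambda>n. map_pmf parent_state (replicate_pmf n (root_law q p m)))"
proof -
  have "root_law q p (Suc m) = bind_pmf q (\<lambda>n. map_pmf (\<lambda>ts. parent_state (map root_state ts))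
      (replicate_pmf n (gw_tree q m) \<bind> (\<lambda>ts. indep_list_pmf (map (leaf_states p) ts))))"
    by (simp add: root_law_def map_bind_pmf bind_assoc_pmf bind_map_pmf map_pmf_comp)
  also have "\<dots> = bind_pmf q (\<lambda>n. map_pmf parent_state (map_pmf (map root_state)
      (replicate_pmf n (gw_tree q m \<bind> leaf_states p))))"
    by (simp add: bind_replicate_indep_list_pmf map_pmf_comp)
  finally show ?thesis by (simp add: map_replicate_pmf root_law_def)
qed

lemma winner_unique: "winner xs i \<Longrightarrow> winner xs j \<Longrightarrow> i = j"
  unfolding winner_def by (metis order.asym)

lemma parent_state_eq_iff: "i \<ge> 1 \<Longrightarrow> parent_state xs = i \<longleftrightarrow> winner xs i"
proof -
  assume i: "i \<ge> 1"
  have "winner xs j \<Longrightarrow> (THE i. winner xs i) = j" for j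
    by (rule the_equality) (auto intro: winner_unique)
  then show ?thesis using i by (auto simp: parent_state_def)
qed

lemma parent_state_eq_0_iff: "parent_state xs = 0 \<longleftrightarrow> (\<forall>i. \<not> winner xs i)"
  using parent_state_eq_iff[of _ xs] by (fastforce simp: parent_state_def winner_def)

lemma winner_in_set:
  assumes "winner xs i"
  shows "i \<in> set xs"
proof -
  \<comment> \<open>\<open>Suc i\<close> serves as an arbitrary competitor: beating it forces at
    least one vote for \<open>i\<close>.\<close>
  have "count_list xs (Suc i) < count_list xs i" using assms by (simp add: winner_def)
  then show ?thesis using count_notin by fastforce
qed

lemma set_pmf_root_law:
  assumes "set_pmf p \<subseteq> {0..k}"
  shows "set_pmf (root_law q p m) \<subseteq> {0..k}"
proof (induction m)
  case (Suc m)
  have "parent_state xs \<le> k" if "set xs \<subseteq> {0..k}" for xs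
  proof (cases "parent_state xs = 0")
    case False
    then have "parent_state xs \<in> set xs"
      using parent_state_eq_iff[of "parent_state xs" xs] by (intro winner_in_set) auto
    with that show ?thesis by auto
  qed simp
  then show ?case using Suc
    by (fastforce simp: root_law_Suc set_replicate_pmf in_lists_conv_set)
qed (simp add: root_law_0 assms)

section \<open>Outcomes of a vote among a fixed number of voters\<close>

text \<open>For \<open>i \<ge> 1\<close> and \<open>n \<ge> 2\<close> this is the coefficient of
  \<open>q_n\<close> in \<open>H_i(P)\<close>.\<close>

definition vote_prob :: "nat pmf \<Rightarrow> nat \<Rightarrow> nat \<Rightarrow> real" where
  "vote_prob P n i = measure_pmf.prob (replicate_pmf n P) {xs. parent_state xs = i}"

lemma vote_prob_nonneg: "0 \<le> vote_prob P n i"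
  and vote_prob_le_1: "vote_prob P n i \<le> 1"
  by (simp_all add: vote_prob_def)

lemma pmf_root_law_Suc:
  "pmf (root_law q p (Suc m)) i = measure_pmf.expectation q (\<lambda>n. vote_prob (root_law q p m) n i)"
  unfolding root_law_Suc pmf_bind pmf_map vote_prob_def by (simp add: vimage_def)

lemma replicate_pmf_Suc_pair:
  "replicate_pmf (Suc n) P = map_pmf (\<lambda>(x, xs). x # xs) (pair_pmf P (replicate_pmf n P))"
  by (simp add: map_pmf_def pair_pmf_def bind_assoc_pmf bind_return_pmf)

lemma pmf_replicate_pmf:
  "pmf (replicate_pmf n P) xs = (if length xs = n then prod_list (map (pmf P) xs) else 0)"
proof (induction n arbitrary: xs)
  case (Suc n)
  show ?case
  proof (cases xs)
    case Nil
    then show ?thesis by (simp add: pmf_eq_0_set_pmf set_replicate_pmf del: replicate_pmf.simps)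
  next
    case (Cons y ys)
    have "pmf (replicate_pmf (Suc n) P) xs = pmf (pair_pmf P (replicate_pmf n P)) (y, ys)"
      unfolding replicate_pmf_Suc_pair Cons using pmf_map_inj'[of "\<lambda>(x, xs). x # xs" _ "(y, ys)"]
      by (auto simp: inj_def)
    then show ?thesis by (simp add: pmf_pair Suc.IH Cons)
  qed
qed (auto simp: pmf_return)

lemma prob_replicate_pmf_mset:
  assumes "size A = n"
  shows "measure_pmf.prob (replicate_pmf n P) {xs. mset xs = A}
    = real (card (permutations_of_multiset A)) * (\<Prod>x\<in>#A. pmf P x)"
proof -
  have "measure_pmf.prob (replicate_pmf n P) {xs. mset xs = A}
      = (\<Sum>xs\<in>permutations_of_multiset A. pmf (replicate_pmf n P) xs)"
    unfolding permutations_of_multiset_def[symmetric]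
    by (rule measure_measure_pmf_finite) simp
  also have "\<dots> = (\<Sum>xs\<in>permutations_of_multiset A. \<Prod>x\<in>#A. pmf P x)"
  proof (rule sum.cong)
    fix xs assume "xs \<in> permutations_of_multiset A"
    then have "mset xs = A" by (simp add: permutations_of_multiset_def)
    moreover from this have "length xs = n" using assms size_mset by metis
    ultimately show "pmf (replicate_pmf n P) xs = (\<Prod>x\<in>#A. pmf P x)"
      by (simp add: pmf_replicate_pmf flip: prod_mset_prod_list)
  qed simp
  finally show ?thesis by simp
qed

text \<open>In all uses \<open>b = c\<close>, so that opinions 1 and 2 tie, and \<open>u\<close> is
  a letter outside \<open>{1, 2}\<close>.\<close>

abbreviation three_letters :: "nat \<Rightarrow> nat \<Rightarrow> nat \<Rightarrow> nat \<Rightarrow> nat multiset" where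
  "three_letters a u b c \<equiv> replicate_mset a u + replicate_mset b 1 + replicate_mset c 2"

text \<open>The multinomial coefficient, multiplied out to avoid division of natural
  numbers.\<close>

lemma card_permutations_of_three:
  assumes "distinct [u, v, w]"
  shows "card (permutations_of_multiset (replicate_mset a u + replicate_mset b v + replicate_mset c w))
    * (fact a * fact b * fact c) = (fact (a + b + c) :: nat)"
proof -
  let ?A = "replicate_mset a u + replicate_mset b v + replicate_mset c w"
  \<comment> \<open>A letter of multiplicity 0 is missing from \<open>set_mset ?A\<close> but
    contributes only \<open>fact 0 = 1\<close>.\<close>
  have "(\<Prod>x\<in>set_mset ?A. fact (count ?A x)) = (\<Prod>x\<in>{u, v, w}. fact (count ?A x) :: nat)"
    by (rule prod.mono_neutral_left) (auto simp: not_in_iff split: if_splits)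
  also have "\<dots> = fact a * fact b * fact c"
    using assms by (auto simp: eq_commute[of v u] eq_commute[of w u] eq_commute[of w v])
  finally show ?thesis using card_permutations_of_multiset_aux[of ?A] by simp
qed

lemma winner_mset:
  "winner xs i \<longleftrightarrow> i \<ge> 1 \<and> (\<forall>j\<ge>1. j \<noteq> i \<longrightarrow> count (mset xs) j < count (mset xs) i)"
  by (simp add: winner_def count_mset)

text \<open>The words retained have one vote for \<open>i\<close> and all other voters undecided.
  When almost everybody is undecided this multiplies a small probability of \<open>i\<close> by
  about \<open>n\<close>.\<close>

lemma vote_prob_ge_single:
  assumes "i \<ge> 1" "n \<ge> 1"
  shows "real n * pmf P i * pmf P 0 ^ (n - 1) \<le> vote_prob P n i"
proof -
  \<comment> \<open>\<open>Suc i\<close> is a dummy letter of multiplicity 0, chosen to be distinct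
    from \<open>0\<close> and \<open>i\<close>.\<close>
  let ?A = "replicate_mset (n - 1) 0 + replicate_mset 1 i + replicate_mset 0 (Suc i)"
  have "card (permutations_of_multiset ?A) * (fact (n - 1) * fact 1 * fact 0) = (fact (n - 1 + 1 + 0) :: nat)"
    by (rule card_permutations_of_three) (use assms in simp)
  also have "\<dots> = n * (fact (n - 1) * fact 1 * fact 0)"
    using assms by (simp add: fact_reduce)
  finally have "card (permutations_of_multiset ?A) = n" by simp
  moreover have "measure_pmf.prob (replicate_pmf n P) {xs. mset xs = ?A}
    = real (card (permutations_of_multiset ?A)) * (\<Prod>x\<in>#?A. pmf P x)"
    by (rule prob_replicate_pmf_mset) (use assms in simp)
  ultimately have "measure_pmf.prob (replicate_pmf n P) {xs. mset xs = ?A}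
      = real n * pmf P i * pmf P 0 ^ (n - 1)" by simp
  moreover have "measure_pmf.prob (replicate_pmf n P) {xs. mset xs = ?A} \<le> vote_prob P n i"
    unfolding vote_prob_def
    by (rule measure_pmf.finite_measure_mono)
       (use assms in \<open>auto simp: parent_state_eq_iff winner_mset\<close>)
  ultimately show ?thesis by simp
qed

lemma vote_prob_ge_power:
  assumes "i \<ge> 1" "n \<ge> 1"
  shows "pmf P i ^ n \<le> vote_prob P n i"
proof -
  have "pmf P i ^ n = measure_pmf.prob (replicate_pmf n P) {replicate n i}"
    by (simp add: measure_pmf_single pmf_replicate_pmf)
  also have "\<dots> \<le> vote_prob P n i"
    unfolding vote_prob_def
    by (rule measure_pmf.finite_measure_mono)
       (use assms in \<open>auto simp: parent_state_eq_iff winner_mset\<close>)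
  finally show ?thesis .
qed

text \<open>The retained words have one letter \<open>u\<close> outside \<open>{1, 2}\<close> and
  \<open>l\<close> votes for each of 1 and 2. For each \<open>u\<close> there are
  \<open>(2 * l + 1) * (2 * l choose l)\<close> of them, which is where
  \<open>central_binomial_ge\<close> enters; summing over \<open>u\<close> gives the mass outside
  \<open>{1, 2}\<close>.\<close>

lemma vote_prob_0_ge:
  assumes "set_pmf P \<subseteq> {0..k}" "k \<ge> 2" "pmf P 1 = pmf P 2" "odd n" "n \<ge> 3"
  shows "3 / 2 * (1 - 2 * pmf P 1) * (2 * pmf P 1) ^ (n - 1) \<le> vote_prob P n 0"
proof -
  obtain l where l: "n = 2 * l + 1" using \<open>odd n\<close> by (rule oddE)
  have l1: "l \<ge> 1" using l assms by simp
  define x where "x = pmf P 1"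
  define U where "U = {0..k} - {1, 2}"
  define T where "T u = {xs. mset xs = three_letters 1 u l l}" for u
  have total: "(\<Sum>u\<in>U. pmf P u) = 1 - 2 * x"
  proof -
    have "(\<Sum>u\<in>{0..k}. pmf P u) = (\<Sum>u\<in>{1, 2}. pmf P u) + (\<Sum>u\<in>U. pmf P u)"
      unfolding U_def using assms by (subst sum.subset_diff[of "{1, 2}"]) auto
    moreover have "(\<Sum>u\<in>{0..k}. pmf P u) = 1" using assms by (intro sum_pmf_eq_1) auto
    moreover have "(\<Sum>u\<in>{1, 2}. pmf P u) = 2 * x" using assms by (simp add: x_def)
    ultimately show ?thesis by linarith
  qed
  have T: "measure_pmf.prob (replicate_pmf n P) (T u)
      = real (2 * l + 1) * real (2 * l choose l) * x ^ (2 * l) * pmf P u" if "u \<in> U" for u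
  proof -
    let ?A = "three_letters 1 u l l"
    have "card (permutations_of_multiset ?A) * (fact 1 * fact l * fact l) = (fact (1 + l + l) :: nat)"
      by (rule card_permutations_of_three) (use that in \<open>simp add: U_def\<close>)
    also have "\<dots> = (2 * l + 1) * fact (2 * l)" by (simp add: mult_2)
    also have "fact (2 * l) = fact l * fact l * (2 * l choose l)"
      using binomial_fact_lemma[of l "2 * l"] by simp
    finally have "card (permutations_of_multiset ?A) * (fact l * fact l)
        = ((2 * l + 1) * (2 * l choose l)) * (fact l * fact l)" by (simp add: mult_ac)
    then have card: "card (permutations_of_multiset ?A) = (2 * l + 1) * (2 * l choose l)" by simp
    have "measure_pmf.prob (replicate_pmf n P) (T u)
        = real (card (permutations_of_multiset ?A)) * (\<Prod>x\<in>#?A. pmf P x)"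
      unfolding T_def by (rule prob_replicate_pmf_mset) (simp add: l)
    also have "(\<Prod>x\<in>#?A. pmf P x) = pmf P u * x ^ (2 * l)"
      using assms by (simp add: x_def mult_2 power_add)
    finally show ?thesis unfolding card by (simp only: of_nat_mult mult_ac)
  qed
  have "3 / 2 * (1 - 2 * x) * (2 * x) ^ (n - 1) = 3 / 2 * 4 ^ l * (x ^ (2 * l) * (1 - 2 * x))"
    by (simp add: l power_mult power_mult_distrib)
  also have "\<dots> \<le> real (2 * l + 1) * real (2 * l choose l) * (x ^ (2 * l) * (1 - 2 * x))"
    using sum_nonneg[of U "pmf P"] unfolding total
    by (intro mult_right_mono central_binomial_ge l1 mult_nonneg_nonneg) (auto simp: x_def)
  also have "\<dots> = (\<Sum>u\<in>U. measure_pmf.prob (replicate_pmf n P) (T u))"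
    by (simp add: T total[symmetric] sum_distrib_left mult.assoc del: of_nat_add of_nat_mult)
  also have "\<dots> = measure_pmf.prob (replicate_pmf n P) (\<Union>u\<in>U. T u)"
  proof (rule measure_pmf.finite_measure_finite_Union[symmetric])
    have "u = v" if "three_letters 1 u l l = three_letters 1 v l l" for u v using that by simp
    then show "disjoint_family_on T U" unfolding disjoint_family_on_def T_def by auto
  qed (auto simp: U_def)
  also have "\<dots> \<le> vote_prob P n 0"
    unfolding vote_prob_def
  proof (rule measure_pmf.finite_measure_mono)
    show "(\<Union>u\<in>U. T u) \<subseteq> {xs. parent_state xs = 0}"
    proof
      fix xs assume "xs \<in> (\<Union>u\<in>U. T u)"
      then obtain u where u: "u \<in> U" and "xs \<in> T u" by blast
      then have c: "count (mset xs) = count (three_letters 1 u l l)" by (simp add: T_def)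
      have "\<not> winner xs i" for i
      proof
        assume "winner xs i"
        then have *: "i \<ge> 1" "\<And>j. j \<ge> 1 \<Longrightarrow> j \<noteq> i \<Longrightarrow> count (mset xs) j < count (mset xs) i"
          by (auto simp: winner_mset)
        show False
        proof (cases "i = 1")
          case True
          with *(2)[of 2] u show False by (auto simp: c U_def)
        next
          \<comment> \<open>Opinion 1 has \<open>l \<ge> 1\<close> votes: as many as opinion 2, and
            at least as many as \<open>u\<close> with its single vote.\<close>
          case False
          with *(2)[of 1] u l1 show False by (auto simp: c U_def split: if_splits)
        qed
      qed
      then show "xs \<in> {xs. parent_state xs = 0}" by (simp add: parent_state_eq_0_iff)
    qed
  qed simp
  finally show ?thesis by (simp add: x_def)
qed

lemma prob_replicate_pmf_subset:
  fixes P :: "'a::countable pmf"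
  shows "measure_pmf.prob (replicate_pmf n P) {xs. set xs \<subseteq> B} = measure_pmf.prob P B ^ n"
proof (induction n)
  case (Suc n)
  have "measure_pmf.prob (replicate_pmf (Suc n) P) {xs. set xs \<subseteq> B}
      = measure_pmf.prob (pair_pmf P (replicate_pmf n P)) (B \<times> {xs. set xs \<subseteq> B})"
    unfolding replicate_pmf_Suc_pair measure_map_pmf by (rule arg_cong[where f = "measure_pmf.prob _"]) auto
  also have "\<dots> = measure_pmf.prob P B * measure_pmf.prob (replicate_pmf n P) {xs. set xs \<subseteq> B}"
    by (rule measure_pmf_prob_product) simp_all
  finally show ?case by (simp add: Suc.IH)
qed simp

text \<open>Both quantities lie between \<open>S\<close> and \<open>S + real n * y\<close>, where
  \<open>S\<close> is the probability of equally many votes for 1 and 2 with all others undecided.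
  The vote exceeds \<open>S\<close> at most by the probability of a letter outside
  \<open>{0, 1, 2}\<close>; \<open>f_poly\<close> exceeds it by giving 1 and 2 the probability
  \<open>w\<close> instead of \<open>x\<close>.\<close>

lemma vote_prob_0_f_poly:
  assumes x: "pmf P 1 = pmf P 2"
  shows "\<bar>vote_prob P n 0 - f_poly n (pmf P 0)\<bar> \<le> real n * (1 - pmf P 0 - 2 * pmf P 1)"
proof -
  define x z y where "x = pmf P 1" and "z = pmf P 0" and "y = 1 - z - 2 * x"
  define w where "w = (1 - z) / 2"
  have *: "measure_pmf.prob P {0, 1, 2} = 1 - y"
    using x by (simp add: measure_measure_pmf_finite x_def z_def y_def)
  then have y: "0 \<le> y" "y \<le> 1" using measure_pmf.prob_le_1[of P "{0, 1, 2}"] measure_nonneg[of P "{0, 1, 2}"]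
    by linarith+
  have xz: "0 \<le> x" "0 \<le> z" "x \<le> w" using y by (simp_all add: x_def z_def y_def w_def)
  have bern: "1 - (1 - y) ^ n \<le> real n * y"
    using Bernoulli_inequality[of "- y" n] y by simp
  define J where "J = {j. 2 * j \<le> n}"
  have fin: "finite J" unfolding J_def by (rule finite_subset[of _ "{..n}"]) auto
  define C where "C j = real (n choose (2 * j)) * real ((2 * j) choose j)" for j
  define S where "S = (\<Sum>j\<in>J. C j * x ^ (2 * j) * z ^ (n - 2 * j))"
  define T where "T j = {xs. mset xs = three_letters (n - 2 * j) 0 j j}" for j
  have T: "measure_pmf.prob (replicate_pmf n P) (T j) = C j * x ^ (2 * j) * z ^ (n - 2 * j)"
    if "j \<in> J" for j
  proof -
    let ?A = "three_letters (n - 2 * j) 0 j j"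
    have jn: "2 * j \<le> n" using that by (simp add: J_def)
    have "card (permutations_of_multiset ?A) * (fact (n - 2 * j) * fact j * fact j)
        = (fact (n - 2 * j + j + j) :: nat)"
      by (rule card_permutations_of_three) simp
    also have "n - 2 * j + j + j = n" using jn by simp
    also have "fact n = fact (2 * j) * fact (n - 2 * j) * (n choose (2 * j))"
      using binomial_fact_lemma[OF jn] by simp
    also have "fact (2 * j) = fact j * fact j * (2 * j choose j)"
      using binomial_fact_lemma[of j "2 * j"] by simp
    finally have "card (permutations_of_multiset ?A) * (fact (n - 2 * j) * fact j * fact j)
        = ((n choose (2 * j)) * (2 * j choose j)) * (fact (n - 2 * j) * fact j * fact j)"
      by (simp only: mult_ac)
    then have card: "card (permutations_of_multiset ?A) = (n choose (2 * j)) * (2 * j choose j)"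
      by simp
    have "measure_pmf.prob (replicate_pmf n P) (T j)
        = real (card (permutations_of_multiset ?A)) * (\<Prod>x\<in>#?A. pmf P x)"
      unfolding T_def by (rule prob_replicate_pmf_mset) (use jn in simp)
    also have "(\<Prod>x\<in>#?A. pmf P x) = x ^ (2 * j) * z ^ (n - 2 * j)"
      using x by (simp add: x_def z_def mult_2 power_add)
    finally show ?thesis unfolding card C_def by (simp only: of_nat_mult mult_ac)
  qed
  have "S = (\<Sum>j\<in>J. measure_pmf.prob (replicate_pmf n P) (T j))"
    by (simp add: S_def T)
  also have "\<dots> = measure_pmf.prob (replicate_pmf n P) (\<Union>j\<in>J. T j)"
  proof (rule measure_pmf.finite_measure_finite_Union[symmetric])
    have "i = j" if "three_letters (n - 2 * i) 0 i i = three_letters (n - 2 * j) 0 j j" for i j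
      using arg_cong[OF that, of "\<lambda>A. count A 1"] by simp
    then show "disjoint_family_on T J" unfolding disjoint_family_on_def T_def by auto
  qed (auto simp: fin)
  finally have S: "S = measure_pmf.prob (replicate_pmf n P) (\<Union>j\<in>J. T j)" .

  have "S \<le> vote_prob P n 0"
    unfolding S vote_prob_def
  proof (rule measure_pmf.finite_measure_mono)
    show "(\<Union>j\<in>J. T j) \<subseteq> {xs. parent_state xs = 0}"
    proof
      fix xs assume "xs \<in> (\<Union>j\<in>J. T j)"
      then obtain j where c: "mset xs = three_letters (n - 2 * j) 0 j j" by (auto simp: T_def)
      have "\<not> winner xs i" for i
      proof
        assume "winner xs i"
        then have *: "i \<ge> 1" "\<And>j. j \<ge> 1 \<Longrightarrow> j \<noteq> i \<Longrightarrow> count (mset xs) j < count (mset xs) i"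
          by (auto simp: winner_mset)
        show False
        proof (cases "i = 1")
          case True
          with *(2)[of 2] show False by (auto simp: c)
        next
          case False
          with *(1) *(2)[of 1] show False by (auto simp: c split: if_splits)
        qed
      qed
      then show "xs \<in> {xs. parent_state xs = 0}" by (simp add: parent_state_eq_0_iff)
    qed
  qed simp
  moreover have "vote_prob P n 0 \<le> S + real n * y"
  proof -
    have "vote_prob P n 0 = measure_pmf.prob (replicate_pmf n P)
        ({xs. parent_state xs = 0} \<inter> set_pmf (replicate_pmf n P))"
      unfolding vote_prob_def by (simp add: measure_Int_set_pmf)
    also have "\<dots> \<le> measure_pmf.prob (replicate_pmf n P)
        ((\<Union>j\<in>J. T j) \<union> (- {xs. set xs \<subseteq> {0, 1, 2}}))"
    proof (rule measure_pmf.finite_measure_mono)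
      show "{xs. parent_state xs = 0} \<inter> set_pmf (replicate_pmf n P)
          \<subseteq> (\<Union>j\<in>J. T j) \<union> (- {xs. set xs \<subseteq> {0, 1, 2}})"
      proof
        fix xs assume "xs \<in> {xs. parent_state xs = 0} \<inter> set_pmf (replicate_pmf n P)"
        then have nw: "\<And>i. \<not> winner xs i" and len: "length xs = n"
          by (auto simp: parent_state_eq_0_iff set_replicate_pmf)
        show "xs \<in> (\<Union>j\<in>J. T j) \<union> (- {xs. set xs \<subseteq> {0, 1, 2}})"
        proof (cases "set xs \<subseteq> {0, 1, 2}")
          case True
          define c where "c = count (mset xs)"
          have zero: "c i = 0" if "i > 2" for i
            using True that by (auto simp: c_def)
          have "c 1 = c 2"
          proof (rule ccontr)
            assume ne: "c 1 \<noteq> c 2"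
            define i where "i = (if c 1 < c 2 then 2 else 1 :: nat)"
            have "c j < c i" if "j \<ge> 1" "j \<noteq> i" for j
            proof -
              have "j = 1 \<or> j = 2 \<or> j > 2" using that by linarith
              then show ?thesis using that ne zero[of j] by (auto simp: i_def split: if_splits)
            qed
            then have "winner xs i" by (auto simp: winner_mset c_def i_def)
            with nw show False by blast
          qed
          have "n = (\<Sum>i\<in>set_mset (mset xs). c i)"
            using size_multiset_overloaded_eq[of "mset xs"] len by (simp add: c_def)
          also have "\<dots> = (\<Sum>i\<in>{0, 1, 2}. c i)"
            using True by (intro sum.mono_neutral_left) (auto simp: c_def)
          finally have n: "n = c 0 + c 1 + c 2" by simp
          have "mset xs = three_letters (n - 2 * c 1) 0 (c 1) (c 1)"
          proof (rule multiset_eqI)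
            fix i :: nat
            have "i = 0 \<or> i = 1 \<or> i = 2 \<or> i > 2" by linarith
            then show "count (mset xs) i = count (three_letters (n - 2 * c 1) 0 (c 1) (c 1)) i"
              using n zero[of i] \<open>c 1 = c 2\<close> by (auto simp: c_def)
          qed
          moreover have "c 1 \<in> J" using n \<open>c 1 = c 2\<close> by (simp add: J_def)
          ultimately show ?thesis unfolding T_def by blast
        qed simp
      qed
    qed simp
    also have "\<dots> \<le> S + measure_pmf.prob (replicate_pmf n P) (- {xs. set xs \<subseteq> {0, 1, 2}})"
      unfolding S by (rule measure_Un_le) auto
    also have "measure_pmf.prob (replicate_pmf n P) (- {xs. set xs \<subseteq> {0, 1, 2}}) = 1 - (1 - y) ^ n"
      using measure_pmf.prob_compl[of "{xs. set xs \<subseteq> {0, 1, 2}}" "replicate_pmf n P"]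
      by (simp add: prob_replicate_pmf_subset *[unfolded One_nat_def] Compl_eq_Diff_UNIV)
    finally show ?thesis using bern by linarith
  qed
  moreover have f: "f_poly n z = (\<Sum>j\<in>J. C j * w ^ (2 * j) * z ^ (n - 2 * j))"
    by (simp add: f_poly_def J_def C_def w_def)
  have "S \<le> f_poly n z"
    unfolding f S_def using xz
    by (intro sum_mono mult_right_mono mult_left_mono power_mono) (auto simp: C_def)
  moreover have "f_poly n z - S \<le> real n * y"
  proof -
    \<comment> \<open>With the central binomials bounded by \<open>4 ^ j\<close> and the nonnegative
      odd terms added, this is bounded by a difference of two full binomial expansions,
      \<open>1 - (1 - y) ^ n\<close>.\<close>
    have "f_poly n z - S = (\<Sum>j\<in>J. real (n choose (2 * j)) * real ((2 * j) choose j)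
        * (w ^ (2 * j) - x ^ (2 * j)) * z ^ (n - 2 * j))"
      unfolding f S_def C_def sum_subtractf[symmetric] by (intro sum.cong) (auto simp: algebra_simps)
    also have "\<dots> \<le> (\<Sum>j\<in>J. real (n choose (2 * j)) * ((2 * w) ^ (2 * j) - (2 * x) ^ (2 * j)) * z ^ (n - 2 * j))"
    proof (rule sum_mono)
      fix j
      have "real ((2 * j) choose j) * (w ^ (2 * j) - x ^ (2 * j)) \<le> 4 ^ j * (w ^ (2 * j) - x ^ (2 * j))"
        using xz by (intro mult_right_mono central_binomial_le) (auto intro: power_mono)
      also have "\<dots> = (2 * w) ^ (2 * j) - (2 * x) ^ (2 * j)"
        using power_mult[of "2::real" 2 j] by (simp add: power_mult_distrib right_diff_distrib)
      finally have "real (n choose (2 * j)) * (real ((2 * j) choose j) * (w ^ (2 * j) - x ^ (2 * j))) * z ^ (n - 2 * j)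
          \<le> real (n choose (2 * j)) * ((2 * w) ^ (2 * j) - (2 * x) ^ (2 * j)) * z ^ (n - 2 * j)"
        using xz by (intro mult_right_mono mult_left_mono) auto
      then show "real (n choose (2 * j)) * real ((2 * j) choose j) * (w ^ (2 * j) - x ^ (2 * j)) * z ^ (n - 2 * j)
          \<le> real (n choose (2 * j)) * ((2 * w) ^ (2 * j) - (2 * x) ^ (2 * j)) * z ^ (n - 2 * j)"
        by (simp only: mult.assoc)
    qed
    also have "\<dots> = (\<Sum>i\<le>n. if even i then real (n choose i) * ((2 * w) ^ i - (2 * x) ^ i) * z ^ (n - i) else 0)"
      unfolding J_def by (rule sum_even_le[symmetric])
    also have "\<dots> \<le> (\<Sum>i\<le>n. real (n choose i) * ((2 * w) ^ i - (2 * x) ^ i) * z ^ (n - i))"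
      using xz by (intro sum_mono) (auto intro!: mult_nonneg_nonneg power_mono)
    also have "\<dots> = (2 * w + z) ^ n - (2 * x + z) ^ n"
      unfolding binomial_ring sum_subtractf[symmetric] by (intro sum.cong) (auto simp: algebra_simps)
    also have "2 * w + z = 1" by (simp add: w_def field_simps)
    also have "2 * x + z = 1 - y" by (simp add: y_def)
    finally show ?thesis using bern by simp
  qed
  ultimately show ?thesis unfolding x_def z_def y_def by linarith
qed

text \<open>Exchanging the letters \<open>i\<close> and \<open>j\<close> turns a word won by \<open>i\<close> into one won by \<open>j\<close> and
  multiplies its probability by a power of \<open>r\<close> with exponent at least \<open>1\<close>, and equal to \<open>n\<close> for
  the constant word.\<close>

lemma vote_prob_swap_le:
  assumes supp: "set_pmf P \<subseteq> {0..k}" and ij: "i \<in> {1..k}" "j \<in> {1..k}" "i \<noteq> j"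
    and r: "pmf P j = r * pmf P i" "0 \<le> r" "r \<le> 1" and "n \<ge> 2"
  shows "vote_prob P n j \<le> r * vote_prob P n i - r * (1 - r) * pmf P i ^ n"
proof -
  define W where "W = {xs. set xs \<subseteq> {0..k} \<and> length xs = n}"
  have fin: "finite W" unfolding W_def by (rule finite_lists_length_eq) simp
  define w where "w xs = prod_list (map (pmf P) xs)" for xs
  have w_nonneg: "w xs \<ge> 0" for xs unfolding w_def by (rule prod_list_nonneg) auto
  have vp: "vote_prob P n u = (\<Sum>xs\<in>{xs\<in>W. winner xs u}. w xs)" if "u \<ge> 1" for u
  proof -
    have "vote_prob P n u = measure_pmf.prob (replicate_pmf n P)
        ({xs. parent_state xs = u} \<inter> set_pmf (replicate_pmf n P))"
      unfolding vote_prob_def by (simp add: measure_Int_set_pmf)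
    also have "\<dots> = measure_pmf.prob (replicate_pmf n P)
        ({xs\<in>W. winner xs u} \<inter> set_pmf (replicate_pmf n P))"
      using supp that
      by (intro arg_cong[where f = "measure_pmf.prob _"])
         (auto simp: W_def parent_state_eq_iff set_replicate_pmf in_lists_conv_set)
    also have "\<dots> = (\<Sum>xs\<in>{xs\<in>W. winner xs u}. pmf (replicate_pmf n P) xs)"
      unfolding measure_Int_set_pmf using fin by (intro measure_measure_pmf_finite) simp
    also have "\<dots> = (\<Sum>xs\<in>{xs\<in>W. winner xs u}. w xs)"
      by (intro sum.cong) (auto simp: pmf_replicate_pmf w_def W_def)
    finally show ?thesis .
  qed
  define \<sigma> where "\<sigma> = Transposition.transpose i j"
  have \<sigma>: "\<sigma> (\<sigma> u) = u" for u by (simp add: \<sigma>_def)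
  have count_\<sigma>: "count_list (map \<sigma> xs) u = count_list xs (\<sigma> u)" for xs u
    by (induction xs) (auto simp: \<sigma>)
  have inj: "inj_on (map \<sigma>) A" for A
    by (rule inj_on_inverseI[where g = "map \<sigma>"]) (simp add: \<sigma> comp_def)
  have W_\<sigma>: "map \<sigma> xs \<in> W" if "xs \<in> W" for xs
    using that ij unfolding W_def \<sigma>_def by (auto simp: Transposition.transpose_def subset_iff)
  have win_\<sigma>: "winner (map \<sigma> xs) j" if "winner xs i" for xs
  proof -
    have "count_list xs (\<sigma> u) < count_list xs i" if u: "u \<ge> 1" "u \<noteq> j" for u
    proof -
      have "\<sigma> u \<ge> 1" "\<sigma> u \<noteq> i"
        using u ij by (auto simp: \<sigma>_def Transposition.transpose_def)
      with \<open>winner xs i\<close> show ?thesis by (simp add: winner_def)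
    qed
    moreover have "\<sigma> j = i" by (simp add: \<sigma>_def)
    ultimately show ?thesis using ij by (auto simp: winner_def count_\<sigma>)
  qed
  have win_\<sigma>': "winner (map \<sigma> xs) i" if "winner xs j" for xs
  proof -
    have "count_list xs (\<sigma> u) < count_list xs j" if u: "u \<ge> 1" "u \<noteq> i" for u
    proof -
      have "\<sigma> u \<ge> 1" "\<sigma> u \<noteq> j"
        using u ij by (auto simp: \<sigma>_def Transposition.transpose_def)
      with \<open>winner xs j\<close> show ?thesis by (simp add: winner_def)
    qed
    moreover have "\<sigma> i = j" by (simp add: \<sigma>_def)
    ultimately show ?thesis using ij by (auto simp: winner_def count_\<sigma>)
  qed
  have img: "{xs\<in>W. winner xs j} = map \<sigma> ` {xs\<in>W. winner xs i}"
  proof (intro set_eqI iffI)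
    fix xs assume "xs \<in> {xs\<in>W. winner xs j}"
    then have "map \<sigma> xs \<in> {xs\<in>W. winner xs i}" using W_\<sigma> win_\<sigma>' by auto
    moreover have "xs = map \<sigma> (map \<sigma> xs)" by (simp add: \<sigma> comp_def)
    ultimately show "xs \<in> map \<sigma> ` {xs\<in>W. winner xs i}" by blast
  qed (use W_\<sigma> win_\<sigma> in auto)
  \<comment> \<open>Written without division by \<open>r\<close>, so that \<open>r = 0\<close> is
    included.\<close>
  have w_\<sigma>: "w (map \<sigma> xs) * r ^ count_list xs j = w xs * r ^ count_list xs i" for xs
  proof (induction xs)
    case (Cons u xs)
    have "pmf P (\<sigma> u) * r ^ (if u = j then 1 else 0) = pmf P u * r ^ (if u = i then 1 else 0)"
      using r ij by (auto simp: \<sigma>_def Transposition.transpose_def)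
    from arg_cong2[OF this Cons.IH, of "(*)"] show ?case
      by (auto simp: w_def mult_ac split: if_splits)
  qed (simp add: w_def)
  define R where "R = replicate n i"
  have R: "R \<in> {xs\<in>W. winner xs i}"
    using ij \<open>n \<ge> 2\<close> by (auto simp: R_def W_def winner_mset)
  have wR: "w R = pmf P i ^ n" by (simp add: w_def R_def)
  have le: "w (map \<sigma> xs) \<le> r * w xs - (if xs = R then r * (1 - r) * pmf P i ^ n else 0)"
    if xs: "winner xs i" for xs
  proof (cases "r = 0")
    \<comment> \<open>Nothing can be cancelled for \<open>r = 0\<close>, but a word won by
      \<open>i\<close> contains \<open>i\<close>, which is mapped to a letter of probability
      0.\<close>
    case True
    have "i \<in> set xs" using xs by (rule winner_in_set)
    then have "0 \<in> set (map (pmf P) (map \<sigma> xs))"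
      using True r ij by (force simp: \<sigma>_def)
    then have "w (map \<sigma> xs) = 0" unfolding w_def prod_list_zero_iff .
    with True show ?thesis by simp
  next
    case False
    then have r0: "r > 0" using r by simp
    define d where "d = count_list xs i - count_list xs j"
    have cl: "count_list xs j < count_list xs i" using xs ij by (simp add: winner_def)
    then have "count_list xs i = d + count_list xs j" by (simp add: d_def)
    with w_\<sigma>[of xs] r0 have eq: "w (map \<sigma> xs) = w xs * r ^ d" by (simp add: power_add)
    show ?thesis
    proof (cases "xs = R")
      \<comment> \<open>In the constant word \<open>j\<close> is absent, so
        \<open>d = n \<ge> 2\<close>, and \<open>r ^ n \<le> r * r = r - r * (1 - r)\<close> yields
        the correction term.\<close>
      case True
      then have "d = n" using ij by (simp add: d_def R_def flip: count_mset)
      have "r ^ n \<le> r ^ 2" using r \<open>n \<ge> 2\<close> by (intro power_decreasing) auto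
      then have "w xs * r ^ d \<le> w xs * (r * r)"
        unfolding \<open>d = n\<close> using w_nonneg by (intro mult_left_mono) (auto simp: power2_eq_square)
      also have "\<dots> = r * w xs - r * (1 - r) * w xs" by (simp add: algebra_simps)
      finally show ?thesis using True wR eq by simp
    next
      case False
      have "r ^ d \<le> r ^ 1" using r cl by (intro power_decreasing) (auto simp: d_def)
      then have "w xs * r ^ d \<le> w xs * r" using w_nonneg by (intro mult_left_mono) auto
      with False show ?thesis by (simp add: eq mult.commute)
    qed
  qed
  have "vote_prob P n j = (\<Sum>xs\<in>{xs\<in>W. winner xs i}. w (map \<sigma> xs))"
    using ij by (subst vp) (auto simp: img sum.reindex[OF inj])
  also have "\<dots> \<le> (\<Sum>xs\<in>{xs\<in>W. winner xs i}. r * w xs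
      - (if xs = R then r * (1 - r) * pmf P i ^ n else 0))"
    by (intro sum_mono le) simp
  also have "\<dots> = r * vote_prob P n i - r * (1 - r) * pmf P i ^ n"
    using R fin ij by (subst vp) (auto simp: sum_subtractf sum_distrib_left)
  finally show ?thesis .
qed

text \<open>For equal probabilities the exchange has ratio 1 in either direction, and its correction
  term vanishes.\<close>

lemma vote_prob_eq:
  assumes "set_pmf P \<subseteq> {0..k}" "i \<in> {1..k}" "j \<in> {1..k}" "pmf P i = pmf P j" "n \<ge> 2"
  shows "vote_prob P n i = vote_prob P n j"
proof (cases "i = j")
  case False
  have "vote_prob P n j \<le> vote_prob P n i"
    using vote_prob_swap_le[of P k i j 1 n] assms False by simp
  moreover have "vote_prob P n i \<le> vote_prob P n j"
    using vote_prob_swap_le[of P k j i 1 n] assms False by simp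
  ultimately show ?thesis by simp
qed simp

subsection \<open>The fixed point and perturbed orbits\<close>

locale offspring_law =
  fixes q :: "nat pmf"
  assumes odd_support: "n \<in> set_pmf q \<Longrightarrow> odd n"
    and ge_3: "n \<in> set_pmf q \<Longrightarrow> n \<ge> 3"
    and integrable_real: "integrable (measure_pmf q) real"
begin

abbreviation E :: "(nat \<Rightarrow> real) \<Rightarrow> real" where
  "E \<equiv> measure_pmf.expectation q"

definition mean :: real where
  "mean = E real"

lemma E_mono:
  assumes "integrable (measure_pmf q) f" "integrable (measure_pmf q) g"
    and "\<And>n. n \<in> set_pmf q \<Longrightarrow> f n \<le> g n"
  shows "E f \<le> E g"
  using assms by (intro integral_mono_AE) (auto simp: AE_measure_pmf_iff)

lemma integrable_bounded:
  assumes "\<And>n. n \<in> set_pmf q \<Longrightarrow> \<bar>f n\<bar> \<le> (1::real)"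
  shows "integrable (measure_pmf q) f"
  using assms by (intro measure_pmf.integrable_const_bound[where B = 1]) (auto simp: AE_measure_pmf_iff)

lemma mean_ge_3: "mean \<ge> 3"
proof -
  have "E (\<lambda>_. 3) \<le> E real"
    by (rule E_mono) (auto simp: integrable_real dest: ge_3)
  then show ?thesis by (simp add: mean_def)
qed

lemma E_affine: "E (\<lambda>n. a * (1 - real n * b)) = a * (1 - mean * b)"
  using integrable_real by (simp add: mean_def)

lemma integrable_affine: "integrable (measure_pmf q) (\<lambda>n. a * (1 - real n * b))"
  using integrable_real by simp

text \<open>Bernoulli's inequality, after lowering \<open>u ^ (n - 1)\<close> to
  \<open>u ^ n\<close>. Bounds affine in \<open>n\<close> integrate against \<open>q\<close> to
  expressions in \<open>mean\<close>.\<close>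

lemma power_ge_affine: "0 \<le> u \<Longrightarrow> u \<le> 1 \<Longrightarrow> 1 - real n * (1 - u) \<le> u ^ (n - 1)" for u :: real
proof -
  assume u: "0 \<le> u" "u \<le> 1"
  have "1 - real n * (1 - u) \<le> u ^ n"
    using Bernoulli_inequality[of "u - 1" n] u by (simp add: algebra_simps)
  also have "\<dots> \<le> u ^ (n - 1)" using u by (intro power_decreasing) auto
  finally show ?thesis .
qed

text \<open>The probability generating function of \<open>q\<close>. At \<open>u = pmf P i\<close>
  it is the probability that all children hold \<open>i\<close>.\<close>

definition gen :: "real \<Rightarrow> real" where
  "gen u = E (\<lambda>n. u ^ n)"

lemma integrable_power: "0 \<le> u \<Longrightarrow> u \<le> 1 \<Longrightarrow> integrable (measure_pmf q) (\<lambda>n. u ^ n)" for u :: real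
  by (rule integrable_bounded) (auto simp: power_le_one)

lemma gen_mono: "0 \<le> u \<Longrightarrow> u \<le> v \<Longrightarrow> v \<le> 1 \<Longrightarrow> gen u \<le> gen v"
  unfolding gen_def by (intro E_mono integrable_power power_mono) auto

lemma gen_pos:
  assumes "0 < u" "u \<le> 1"
  shows "0 < gen u"
proof -
  obtain n where n: "n \<in> set_pmf q" using set_pmf_not_empty[of q] by blast
  have "0 < pmf q n * u ^ n" using n assms by (simp add: pmf_positive)
  also have "\<dots> = E (\<lambda>m. indicator {n} m * u ^ n)"
    by (simp add: measure_pmf_single)
  also have "\<dots> \<le> gen u"
    unfolding gen_def using assms
    by (intro E_mono integrable_power integrable_bounded)
       (auto simp: indicator_def power_le_one)
  finally show ?thesis .
qed

section \<open>The map \<open>f\<close> as an expectation\<close>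

text \<open>Working form of \<open>f_map\<close>: inequalities and convexity of the single
  \<open>f_poly n\<close> pass to it through the expectation.\<close>

definition F :: "real \<Rightarrow> real" where
  "F t = E (\<lambda>n. f_poly n t)"

lemma integrable_f_poly: "0 \<le> t \<Longrightarrow> t \<le> 1 \<Longrightarrow> integrable (measure_pmf q) (\<lambda>n. f_poly n t)"
  using f_poly_nonneg f_poly_le_1 by (intro integrable_bounded) (auto simp: abs_le_iff intro: order_trans[of _ 0])

text \<open>The support of \<open>q\<close> lies in the odd numbers from 3 on, that is in the
  numbers \<open>2 * n + 1\<close> with \<open>n \<ge> 1\<close>; absolute summability turns the
  expectation into an infinite sum.\<close>

lemma f_map_eq_F:
  assumes "0 \<le> t" "t \<le> 1"
  shows "f_map q t = F t"
proof -
  let ?g = "\<lambda>n. pmf q n * f_poly n t"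
  have "Infinite_Set_Sum.abs_summable_on ?g UNIV"
  proof (rule abs_summable_on_comparison_test)
    show "Infinite_Set_Sum.abs_summable_on (pmf q) UNIV" by (rule pmf_abs_summable)
    show "norm (pmf q n * f_poly n t) \<le> norm (pmf q n)" for n
      using f_poly_nonneg[OF assms] f_poly_le_1[OF assms] by (simp add: mult_left_le)
  qed
  then have "F t = infsum ?g UNIV"
    unfolding F_def by (simp add: pmf_expectation_eq_infsetsum infsetsum_infsum)
  also have "\<dots> = infsum ?g ((\<lambda>n. 2 * n + 1) ` {1..})"
  proof (rule infsum_cong_neutral)
    fix n :: nat assume "n \<in> UNIV - (\<lambda>n. 2 * n + 1) ` {1..}"
    moreover have "n \<in> (\<lambda>n. 2 * n + 1) ` {1..}" if n: "n \<in> set_pmf q"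
    proof -
      obtain l where l: "n = 2 * l + 1" using odd_support[OF n] by (rule oddE)
      then have "l \<in> {1..}" using ge_3[OF n] by simp
      with l show ?thesis by (rule image_eqI)
    qed
    ultimately have "n \<notin> set_pmf q" by blast
    then show "?g n = 0" by (simp add: pmf_eq_0_set_pmf)
  qed auto
  also have "\<dots> = f_map q t"
    unfolding f_map_def by (subst infsum_reindex) (auto simp: inj_on_def comp_def)
  finally show ?thesis by simp
qed

lemma F_mono: "0 \<le> s \<Longrightarrow> s \<le> t \<Longrightarrow> t \<le> 1 \<Longrightarrow> F s \<le> F t"
  unfolding F_def by (intro E_mono integrable_f_poly f_poly_mono odd_support) auto

lemma F_1: "F 1 = 1"
proof -
  have "f_poly n 1 = 1" for n by (subst f_poly_average[of n "Suc n"]) auto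
  then show ?thesis by (simp add: F_def)
qed

text \<open>\<open>f_poly_ge\<close> and Bernoulli give slope 3/2 up to the factor
  \<open>1 - mean * t\<close>. Below the threshold 1/3 this factor exceeds 2/3, and 3/2 times 2/3 is
  1.\<close>

lemma F_gt_near_0:
  assumes "0 < t" "mean * t < 1 / 3"
  shows "t < F t"
proof -
  have "3 * t \<le> mean * t" using mean_ge_3 assms by (intro mult_right_mono) auto
  then have t: "t \<le> 1" using assms by linarith
  have "t < 3 / 2 * t * (1 - mean * t)"
    using mult_strict_left_mono[OF assms(2), of "3 / 2 * t"] assms(1) by (simp add: algebra_simps)
  also have "\<dots> = E (\<lambda>n. 3 / 2 * t * (1 - real n * t))" by (rule E_affine[symmetric])
  also have "\<dots> \<le> F t"
    unfolding F_def
  proof (intro E_mono integrable_affine integrable_f_poly)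
    fix n assume n: "n \<in> set_pmf q"
    have "3 / 2 * t * (1 - real n * t) \<le> 3 / 2 * t * (1 - t) ^ (n - 1)"
      using power_ge_affine[of "1 - t" n] assms t by (intro mult_left_mono) auto
    also have "\<dots> \<le> f_poly n t"
      using n assms t by (intro f_poly_ge odd_support ge_3) auto
    finally show "3 / 2 * t * (1 - real n * t) \<le> f_poly n t" .
  qed (use assms t in auto)
  finally show ?thesis .
qed

text \<open>The deficit in \<open>f_poly_le\<close> is at least
  \<open>3 * s * (1 - real n * s)\<close> because \<open>n \<ge> 3\<close>. Below the threshold its
  mean exceeds \<open>2 * s\<close>, more than the \<open>s\<close> required.\<close>

lemma F_lt_near_1:
  assumes "0 < s" "mean * s < 1 / 3"
  shows "F (1 - s) < 1 - s"
proof -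
  have "3 * s \<le> mean * s" using mean_ge_3 assms by (intro mult_right_mono) auto
  then have s: "s \<le> 1" using assms by linarith
  have "F (1 - s) \<le> E (\<lambda>n. 1 - 3 * s * (1 - real n * s))"
    unfolding F_def
  proof (intro E_mono Bochner_Integration.integrable_diff integrable_affine integrable_f_poly)
    fix n assume n: "n \<in> set_pmf q"
    then have "n \<ge> 3" by (rule ge_3)
    have "3 * s * (1 - real n * s) \<le> 3 * s * (1 - s) ^ (n - 1)"
      using power_ge_affine[of "1 - s" n] assms s by (intro mult_left_mono) auto
    also have "\<dots> \<le> real n * s * (1 - s) ^ (n - 1)"
      using \<open>n \<ge> 3\<close> assms s by (intro mult_right_mono) auto
    finally have "3 * s * (1 - real n * s) \<le> real n * s * (1 - s) ^ (n - 1)" .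
    moreover have "f_poly n (1 - s) \<le> 1 - real n * s * (1 - s) ^ (n - 1)"
      using f_poly_le[of n "1 - s"] \<open>n \<ge> 3\<close> assms s by simp
    ultimately show "f_poly n (1 - s) \<le> 1 - 3 * s * (1 - real n * s)" by linarith
  qed (use assms s in auto)
  also have "\<dots> = E (\<lambda>_. 1) - E (\<lambda>n. 3 * s * (1 - real n * s))"
    by (intro Bochner_Integration.integral_diff integrable_affine) simp
  also have "\<dots> = 1 - 3 * s * (1 - mean * s)"
    unfolding E_affine by simp
  also have "\<dots> < 1 - s"
    using mult_strict_left_mono[OF assms(2), of "3 * s"] assms(1) by (simp add: algebra_simps)
  finally show ?thesis .
qed

text \<open>Convexity is inherited from each \<open>f_poly n\<close>. The endpoint 1 is included
  because a chord in the proof of \<open>fixed_point\<close> ends there.\<close>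

lemma convex_on_F_quotient: "convex_on {0<..1} (\<lambda>t. F t / t)"
proof (rule convex_onI)
  fix u x y :: real assume u: "0 < u" "u < 1" and xy: "x \<in> {0<..1}" "y \<in> {0<..1}"
  define w where "w = (1 - u) * x + u * y"
  have "w \<in> {0<..1}"
    using convexD[of "{0<..1::real}" x y "1 - u" u] u xy by (simp add: w_def)
  then have int: "integrable (measure_pmf q) (\<lambda>n. f_poly n t / t)" if "t \<in> {x, y, w}" for t
    using xy that by (intro Bochner_Integration.integrable_divide integrable_f_poly) auto
  have "E (\<lambda>n. f_poly n w / w) \<le> E (\<lambda>n. (1 - u) * (f_poly n x / x) + u * (f_poly n y / y))"
  proof (intro E_mono int Bochner_Integration.integrable_add integrable_mult_right)
    fix n assume "n \<in> set_pmf q"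
    then have "convex_on {0<..} (\<lambda>t. f_poly n t / t)"
      by (intro convex_on_f_poly_quotient odd_support)
    from convex_onD[OF this, of u x y] u xy
    show "f_poly n w / w \<le> (1 - u) * (f_poly n x / x) + u * (f_poly n y / y)"
      by (simp add: w_def)
  qed auto
  also have "\<dots> = (1 - u) * E (\<lambda>n. f_poly n x / x) + u * E (\<lambda>n. f_poly n y / y)"
    using Bochner_Integration.integral_add[OF integrable_mult_right[OF int[of x], of "1 - u"]
        integrable_mult_right[OF int[of y], of u]]
    by (simp del: times_divide_eq_right)
  finally show "F ((1 - u) *\<^sub>R x + u *\<^sub>R y) / ((1 - u) *\<^sub>R x + u *\<^sub>R y)
      \<le> (1 - u) * (F x / x) + u * (F y / y)"
    by (simp add: F_def w_def)
qed simp

text \<open>Convex functions are continuous on open intervals, which avoids exchanging a limit with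
  the expectation.\<close>

lemma continuous_on_F: "continuous_on {0<..<1} F"
proof -
  have "continuous_on {0<..<1} (\<lambda>t. F t / t)"
    by (intro convex_on_continuous convex_on_subset[OF convex_on_F_quotient]) auto
  then have "continuous_on {0<..<1} (\<lambda>t. t * (F t / t))"
    by (intro continuous_on_mult continuous_on_id)
  then show ?thesis by (rule continuous_on_eq) auto
qed

text \<open>The quotient \<open>F t / t\<close> is convex, exceeds \<open>1\<close> near \<open>0\<close>, is below \<open>1\<close> just left of \<open>1\<close>
  and equals \<open>1\<close> at \<open>1\<close>, so that it crosses the level \<open>1\<close> exactly once in \<open>(0, 1)\<close>.\<close>

lemma fixed_point:
  obtains \<alpha> where "0 < \<alpha>" "\<alpha> < 1" "F \<alpha> = \<alpha>"
    "\<And>t. 0 < t \<Longrightarrow> t < \<alpha> \<Longrightarrow> t < F t" "\<And>t. \<alpha> < t \<Longrightarrow> t < 1 \<Longrightarrow> F t < t"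
proof -
  define h where "h = (\<lambda>t. F t / t)"
  \<comment> \<open>Then \<open>mean * s = 1 / 4\<close> is below the threshold 1/3 of both local
    estimates, and \<open>mean \<ge> 3\<close> gives \<open>s \<le> 1 / 12\<close>, hence
    \<open>s < 1 - s\<close>.\<close>
  define s where "s = 1 / (4 * mean)"
  have s: "s > 0" "mean * s < 1 / 3" "s \<le> 1 / 12"
    using mean_ge_3 by (auto simp: s_def field_simps)
  define b where "b = 1 - s"
  have sb: "s < b" "b < 1" "0 < b" using s by (auto simp: b_def)
  have hs: "h s > 1" using F_gt_near_0[OF s(1,2)] s by (simp add: h_def)
  have hb: "h b < 1" using F_lt_near_1[OF s(1,2)] sb by (simp add: h_def b_def)
  have h1: "h 1 = 1" by (simp add: h_def F_1)
  \<comment> \<open>Convexity: at most 1 at both ends and below 1 at one of them implies below 1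
    strictly inside.\<close>
  have chord: "h y < 1" if "0 < x" "x < y" "y < z" "z \<le> 1" "h x \<le> 1" "h z \<le> 1" "h x < 1 \<or> h z < 1" for x y z
  proof -
    define u where "u = (y - x) / (z - x)"
    have u: "0 < u" "u < 1" using that by (auto simp: u_def)
    have "u * (z - x) = y - x" using that by (simp add: u_def)
    then have y: "y = (1 - u) * x + u * z" by (simp add: algebra_simps)
    have "h y \<le> (1 - u) * h x + u * h z"
      using convex_onD[OF convex_on_F_quotient, of u x z] u that by (simp add: y h_def)
    also have "\<dots> < 1"
    proof (cases "h x < 1")
      case True
      then have "(1 - u) * h x < (1 - u) * 1" using u by (intro mult_strict_left_mono) auto
      moreover have "u * h z \<le> u * 1" using u that by (intro mult_left_mono) auto
      ultimately have "(1 - u) * h x + u * h z < (1 - u) * 1 + u * 1" by (rule add_less_le_mono)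
      then show ?thesis by simp
    next
      case False
      then have "u * h z < u * 1" using u that by (intro mult_strict_left_mono) auto
      moreover have "(1 - u) * h x \<le> (1 - u) * 1" using u that by (intro mult_left_mono) auto
      ultimately have "(1 - u) * h x + u * h z < (1 - u) * 1 + u * 1" by (rule add_le_less_mono[rotated])
      then show ?thesis by simp
    qed
    finally show ?thesis .
  qed
  have "continuous_on {s..b} h"
    unfolding h_def using s sb
    by (intro continuous_on_divide continuous_on_subset[OF continuous_on_F] continuous_on_id) auto
  then obtain \<alpha> where \<alpha>: "s \<le> \<alpha>" "\<alpha> \<le> b" "h \<alpha> = 1"
    using IVT2'[of h b 1 s] hs hb sb by auto
  have "\<alpha> \<noteq> b" using \<alpha> hb by auto
  with \<alpha> have \<alpha>b: "0 < \<alpha>" "\<alpha> < b" using s by auto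
  show thesis
  proof
    show "0 < \<alpha>" "\<alpha> < 1" using \<alpha>b sb by auto
    show "F \<alpha> = \<alpha>" using \<alpha>(3) \<alpha>b by (simp add: h_def)
    fix t
    show "t < F t" if "0 < t" "t < \<alpha>"
    proof (rule ccontr)
      \<comment> \<open>Otherwise the chord from \<open>t\<close> to \<open>b\<close> would bring
        \<open>h\<close> below 1 at \<open>\<alpha>\<close>.\<close>
      assume "\<not> t < F t"
      then have "h t \<le> 1" using that by (simp add: h_def)
      then have "h \<alpha> < 1" using that \<alpha>b sb hb by (intro chord[of t \<alpha> b]) auto
      with \<alpha> show False by simp
    qed
    show "F t < t" if "\<alpha> < t" "t < 1"
    proof -
      \<comment> \<open>Left of \<open>b\<close> the chord runs from \<open>\<alpha>\<close> to
        \<open>b\<close>, right of it from \<open>b\<close> to 1; \<open>b\<close> is the strict end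
        both times.\<close>
      consider "t < b" | "t = b" | "b < t" by linarith
      then have "h t < 1"
      proof cases
        case 1
        with that \<alpha> \<alpha>b sb hb show ?thesis by (intro chord[of \<alpha> t b]) auto
      next
        case 2
        with hb show ?thesis by simp
      next
        case 3
        with that \<alpha> \<alpha>b sb hb h1 show ?thesis by (intro chord[of b t 1]) auto
      qed
      then show ?thesis using that \<alpha>b by (simp add: h_def)
    qed
  qed
qed

end

section \<open>Convergence of perturbed orbits\<close>

text \<open>Let \<open>L\<close> be the infimum of the eventual upper bounds of \<open>u\<close>
  that are not below \<open>\<alpha>\<close>. If \<open>L > \<alpha>\<close>, then
  \<open>F L < L\<close>, and one more iteration from an eventual bound slightly above
  \<open>L\<close> produces an eventual bound below \<open>L\<close>.\<close>

lemma eventually_less_of_perturbed_iteration: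
  fixes F :: "real \<Rightarrow> real" and u :: "nat \<Rightarrow> real"
  assumes I: "I = {lo<..<hi}"
    and mono: "\<And>x y. x \<in> I \<Longrightarrow> y \<in> I \<Longrightarrow> x \<le> y \<Longrightarrow> F x \<le> F y"
    and cont: "continuous_on I F"
    and \<alpha>: "\<alpha> \<in> I" "\<And>t. t \<in> I \<Longrightarrow> \<alpha> < t \<Longrightarrow> F t < t"
    and u: "\<And>m. u m \<in> I" "\<And>m. u m \<le> b" "b \<in> I"
    and lim: "(\<lambda>m. u (Suc m) - F (u m)) \<longlonglongrightarrow> 0"
    and c: "\<alpha> < c"
  shows "eventually (\<lambda>m. u m < c) sequentially"
proof -
  \<comment> \<open>The condition \<open>\<alpha> \<le> B\<close> bounds \<open>S\<close> below and
    keeps \<open>L\<close> inside \<open>I\<close>.\<close>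
  define S where "S = {B. \<alpha> \<le> B \<and> eventually (\<lambda>m. u m \<le> B) sequentially}"
  have mS: "max \<alpha> b \<in> S" using u by (auto simp: S_def intro!: always_eventually simp: le_max_iff_disj)
  have bdd: "bdd_below S" by (rule bdd_belowI[of _ \<alpha>]) (simp add: S_def)
  define L where "L = Inf S"
  have L1: "\<alpha> \<le> L" unfolding L_def using mS by (intro cInf_greatest) (blast, simp add: S_def)
  have L2: "L \<le> max \<alpha> b" unfolding L_def by (rule cInf_lower[OF mS bdd])
  have LI: "L \<in> I" using L1 L2 \<alpha>(1) u(3) by (auto simp: I max_def split: if_splits)
  have ev: "eventually (\<lambda>m. u m \<le> B) sequentially" if LB: "L < B" for B
  proof -
    have "S \<noteq> {}" using mS by blast
    then obtain B' where B': "B' \<in> S" "B' < B"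
      using cInf_lessD[of S B] LB unfolding L_def by blast
    then have "eventually (\<lambda>m. u m \<le> B') sequentially" by (simp add: S_def)
    then show ?thesis by (rule eventually_mono) (use B' in simp)
  qed
  have "L = \<alpha>"
  proof (rule ccontr)
    assume "L \<noteq> \<alpha>"
    with L1 have L: "\<alpha> < L" by simp
    \<comment> \<open>One third of the gap pays for the continuity of \<open>F\<close> right of
      \<open>L\<close>, one third for the perturbation, and the last third is the gain.\<close>
    define g where "g = (L - F L) / 3"
    have g: "g > 0" using \<alpha>(2)[OF LI L] by (simp add: g_def)
    have "isCont F L" using cont LI by (simp add: I continuous_on_eq_continuous_at)
    then have "(F \<longlongrightarrow> F L) (at_right L)"
      unfolding isCont_def by (rule tendsto_mono[OF at_le[OF subset_UNIV]])
    then have "eventually (\<lambda>x. F x < F L + g) (at_right L)"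
      using g by (intro order_tendstoD(2)) auto
    moreover have "eventually (\<lambda>x. x \<in> {L<..<hi}) (at_right L)"
      using LI by (intro eventually_at_right_real) (simp add: I)
    ultimately have "eventually (\<lambda>x. F x < F L + g \<and> x \<in> {L<..<hi}) (at_right L)"
      by (rule eventually_conj)
    then obtain B where B: "F B < F L + g" "L < B" "B < hi"
      using eventually_happens'[of "at_right L"] by (auto simp: trivial_limit_at_right_real)
    then have BI: "B \<in> I" using LI by (simp add: I)
    have "eventually (\<lambda>m. u (Suc m) - F (u m) < g) sequentially"
      using lim g by (rule order_tendstoD)
    with ev[OF B(2)] have "eventually (\<lambda>m. u (Suc m) \<le> L - g) sequentially"
    proof eventually_elim
      case (elim m)
      have "F (u m) \<le> F B" using elim u BI by (intro mono) auto
      moreover have "F L + g + g = L - g" by (simp add: g_def field_simps)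
      ultimately show ?case using elim B by linarith
    qed
    then have "eventually (\<lambda>m. u m \<le> L - g) sequentially"
      using eventually_sequentially_Suc[of "\<lambda>m. u m \<le> L - g"] by blast
    then have "max \<alpha> (L - g) \<in> S"
      unfolding S_def by (auto elim!: eventually_mono)
    then have "L \<le> max \<alpha> (L - g)" unfolding L_def by (rule cInf_lower[OF _ bdd])
    with L g show False by auto
  qed
  with c have "L < (\<alpha> + c) / 2" by simp
  from ev[OF this] show ?thesis by (rule eventually_mono) (use c in auto)
qed

context offspring_law
begin

lemma perturbed_iteration_tendsto:
  assumes \<alpha>: "0 < \<alpha>" "\<alpha> < 1" "\<And>t. 0 < t \<Longrightarrow> t < \<alpha> \<Longrightarrow> t < F t" "\<And>t. \<alpha> < t \<Longrightarrow> t < 1 \<Longrightarrow> F t < t"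
    and u: "\<And>m. a \<le> u m" "\<And>m. u m \<le> b" "0 < a" "b < 1"
    and lim: "(\<lambda>m. u (Suc m) - F (u m)) \<longlonglongrightarrow> 0"
  shows "u \<longlonglongrightarrow> \<alpha>"
proof (rule order_tendstoI)
  have ab: "a \<le> b" using u(1)[of 0] u(2)[of 0] by linarith
  have uI: "0 < u m" "u m < 1" for m using u(1)[of m] u(2)[of m] u(3,4) by linarith+
  fix c assume "\<alpha> < c"
  then show "eventually (\<lambda>m. u m < c) sequentially"
    using \<alpha> u ab uI
    by (intro eventually_less_of_perturbed_iteration[OF refl _ continuous_on_F _ _ _ _ _ lim, of \<alpha> b])
       (auto intro: F_mono)
next
  have ab: "a \<le> b" using u(1)[of 0] u(2)[of 0] by linarith
  have uI: "0 < u m" "u m < 1" for m using u(1)[of m] u(2)[of m] u(3,4) by linarith+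
  fix c assume c: "c < \<alpha>"
  \<comment> \<open>The lower estimate is the upper one reflected by sending \<open>t\<close> to
    \<open>1 - t\<close>: the conjugate \<open>G\<close> is again monotone, and
    \<open>t < F t\<close> left of \<open>\<alpha>\<close> becomes \<open>G t < t\<close> right of
    \<open>1 - \<alpha>\<close>.\<close>
  define G where "G t = 1 - F (1 - t)" for t
  have "continuous_on {0<..<1} G"
    unfolding G_def
    by (intro continuous_intros continuous_on_compose2[OF continuous_on_F]) auto
  moreover have "(\<lambda>m. (1 - u (Suc m)) - G (1 - u m)) \<longlonglongrightarrow> 0"
    using tendsto_minus[OF lim] by (simp add: G_def)
  moreover have "G t < t" if "1 - \<alpha> < t" "t < 1" for t
    using \<alpha>(3)[of "1 - t"] that by (simp add: G_def)
  moreover have "G x \<le> G y" if "0 < x" "x \<le> y" "y < 1" for x y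
    using F_mono[of "1 - y" "1 - x"] that by (simp add: G_def)
  ultimately have "eventually (\<lambda>m. 1 - u m < 1 - c) sequentially"
    using \<alpha>(1,2) u ab uI c
    by (intro eventually_less_of_perturbed_iteration[where u = "\<lambda>m. 1 - u m", OF refl, of 0 1 G "1 - \<alpha>" "1 - a"]) auto
  then show "eventually (\<lambda>m. c < u m) sequentially" by simp
qed

end

subsection \<open>Dynamics of the root law\<close>

lemma sum_pmf_eq_split_01_2:
  fixes P :: "nat pmf"
  assumes "set_pmf P \<subseteq> {0..k}" "k \<ge> 2"
  shows "pmf P 0 + pmf P 1 + pmf P 2 + (\<Sum>j\<in>{3..k}. pmf P j) = 1"
proof -
  have "{0..k} = {0, 1, 2} \<union> {3..k}" using assms by auto
  then have "(\<Sum>j\<in>{0..k}. pmf P j) = (\<Sum>j\<in>{0, 1, 2}. pmf P j) + (\<Sum>j\<in>{3..k}. pmf P j)"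
    by (simp only:) (rule sum.union_disjoint, auto)
  moreover have "(\<Sum>j\<in>{0..k}. pmf P j) = 1" using assms by (intro sum_pmf_eq_1) auto
  ultimately show ?thesis by simp
qed

context offspring_law
begin

section \<open>Vote probabilities averaged over the number of children\<close>

lemma integrable_vote_prob: "integrable (measure_pmf q) (\<lambda>n. vote_prob P n i)"
  by (rule integrable_bounded) (simp add: abs_le_iff vote_prob_le_1 order_trans[OF _ vote_prob_nonneg])

lemma E_vote_prob_eq:
  assumes "set_pmf P \<subseteq> {0..k}" "i \<in> {1..k}" "j \<in> {1..k}" "pmf P i = pmf P j"
  shows "E (\<lambda>n. vote_prob P n i) = E (\<lambda>n. vote_prob P n j)"
proof (intro integral_cong_AE)
  show "AE n in measure_pmf q. vote_prob P n i = vote_prob P n j"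
    using assms ge_3 by (fastforce simp: AE_measure_pmf_iff intro!: vote_prob_eq)
qed auto

lemma E_vote_prob_swap_le:
  assumes "set_pmf P \<subseteq> {0..k}" "i \<in> {1..k}" "j \<in> {1..k}" "i \<noteq> j"
    and "pmf P j = r * pmf P i" "0 \<le> r" "r \<le> 1"
  shows "E (\<lambda>n. vote_prob P n j) \<le> r * E (\<lambda>n. vote_prob P n i) - r * (1 - r) * gen (pmf P i)"
proof -
  have "E (\<lambda>n. vote_prob P n j) \<le> E (\<lambda>n. r * vote_prob P n i - r * (1 - r) * pmf P i ^ n)"
    using assms ge_3
    by (intro E_mono integrable_vote_prob Bochner_Integration.integrable_diff
        integrable_mult_right integrable_power vote_prob_swap_le) (fastforce simp: pmf_le_1)+
  also have "\<dots> = r * E (\<lambda>n. vote_prob P n i) - r * (1 - r) * gen (pmf P i)"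
    unfolding gen_def
    by (subst Bochner_Integration.integral_diff)
       (auto intro!: integrable_vote_prob integrable_power simp: pmf_le_1)
  finally show ?thesis .
qed

lemma E_vote_prob_ge_gen:
  assumes "i \<ge> 1"
  shows "gen (pmf P i) \<le> E (\<lambda>n. vote_prob P n i)"
  unfolding gen_def using assms
  by (intro E_mono integrable_power integrable_vote_prob vote_prob_ge_power)
     (auto simp: pmf_le_1 dest: ge_3)

text \<open>Meant for \<open>pmf P 0\<close> close to 1, where a small probability of
  \<open>i\<close> grows at least by a factor close to 3.\<close>

lemma E_vote_prob_ge_single:
  assumes "i \<ge> 1"
  shows "3 * pmf P i * (1 - mean * (1 - pmf P 0)) \<le> E (\<lambda>n. vote_prob P n i)"
proof -
  have "3 * pmf P i * (1 - mean * (1 - pmf P 0)) = E (\<lambda>n. 3 * pmf P i * (1 - real n * (1 - pmf P 0)))"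
    by (rule E_affine[symmetric])
  also have "\<dots> \<le> E (\<lambda>n. vote_prob P n i)"
  proof (intro E_mono integrable_affine integrable_vote_prob)
    fix n assume "n \<in> set_pmf q"
    then have n: "n \<ge> 3" by (rule ge_3)
    have "3 * pmf P i * (1 - real n * (1 - pmf P 0)) \<le> 3 * pmf P i * pmf P 0 ^ (n - 1)"
      by (intro mult_left_mono power_ge_affine) (auto simp: pmf_le_1)
    also have "\<dots> \<le> real n * pmf P i * pmf P 0 ^ (n - 1)"
      using n by (intro mult_right_mono) auto
    also have "\<dots> \<le> vote_prob P n i" using assms n by (intro vote_prob_ge_single) auto
    finally show "3 * pmf P i * (1 - real n * (1 - pmf P 0)) \<le> vote_prob P n i" .
  qed
  finally show ?thesis .
qed

text \<open>Here \<open>s\<close> is the mass outside \<open>{1, 2}\<close>. The first bound serves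
  for small \<open>s\<close>, the second for \<open>s\<close> away from 0, where the first may be
  negative.\<close>

lemma E_vote_prob_0_ge:
  assumes P: "set_pmf P \<subseteq> {0..k}" "k \<ge> 2" "pmf P 1 = pmf P 2"
  defines "s \<equiv> 1 - 2 * pmf P 1"
  shows "3 / 2 * s * (1 - mean * s) \<le> E (\<lambda>n. vote_prob P n 0)"
    and "3 / 2 * s * gen (1 - s) \<le> E (\<lambda>n. vote_prob P n 0)"
proof -
  have s: "0 \<le> s" "s \<le> 1"
  proof -
    have "0 \<le> (\<Sum>j\<in>{3..k}. pmf P j)" by (simp add: sum_nonneg)
    then show "0 \<le> s"
      using sum_pmf_eq_split_01_2[OF P(1,2)] P(3) pmf_nonneg[of P 0] unfolding s_def by linarith
  qed (simp add: s_def)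
  have vp: "3 / 2 * s * (1 - s) ^ (n - 1) \<le> vote_prob P n 0" if "n \<in> set_pmf q" for n
    using vote_prob_0_ge[OF P odd_support[OF that] ge_3[OF that]] by (simp add: s_def)
  have "3 / 2 * s * (1 - mean * s) = E (\<lambda>n. 3 / 2 * s * (1 - real n * s))"
    by (rule E_affine[symmetric])
  also have "\<dots> \<le> E (\<lambda>n. vote_prob P n 0)"
  proof (intro E_mono integrable_affine integrable_vote_prob)
    fix n assume "n \<in> set_pmf q"
    have "3 / 2 * s * (1 - real n * s) \<le> 3 / 2 * s * (1 - s) ^ (n - 1)"
      using power_ge_affine[of "1 - s" n] s by (intro mult_left_mono) auto
    with vp[OF \<open>n \<in> set_pmf q\<close>] show "3 / 2 * s * (1 - real n * s) \<le> vote_prob P n 0" by linarith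
  qed
  finally show "3 / 2 * s * (1 - mean * s) \<le> E (\<lambda>n. vote_prob P n 0)" .
  have "3 / 2 * s * gen (1 - s) = E (\<lambda>n. 3 / 2 * s * (1 - s) ^ n)" by (simp add: gen_def)
  also have "\<dots> \<le> E (\<lambda>n. vote_prob P n 0)"
  proof (intro E_mono integrable_vote_prob integrable_mult_right integrable_power)
    fix n assume "n \<in> set_pmf q"
    have "3 / 2 * s * (1 - s) ^ n \<le> 3 / 2 * s * (1 - s) ^ (n - 1)"
      using s by (intro mult_left_mono power_decreasing) auto
    with vp[OF \<open>n \<in> set_pmf q\<close>] show "3 / 2 * s * (1 - s) ^ n \<le> vote_prob P n 0" by linarith
  qed (use s in auto)
  finally show "3 / 2 * s * gen (1 - s) \<le> E (\<lambda>n. vote_prob P n 0)" .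
qed

lemma E_vote_prob_0_F:
  assumes "pmf P 1 = pmf P 2"
  shows "\<bar>E (\<lambda>n. vote_prob P n 0) - F (pmf P 0)\<bar> \<le> mean * (1 - pmf P 0 - 2 * pmf P 1)"
proof -
  let ?y = "1 - pmf P 0 - 2 * pmf P 1"
  have int: "integrable (measure_pmf q) (\<lambda>n. f_poly n (pmf P 0))"
    by (rule integrable_f_poly) (auto simp: pmf_le_1)
  have "E (\<lambda>n. vote_prob P n 0) - F (pmf P 0) = E (\<lambda>n. vote_prob P n 0 - f_poly n (pmf P 0))"
    unfolding F_def by (rule Bochner_Integration.integral_diff[symmetric, OF integrable_vote_prob int])
  also have "\<bar>\<dots>\<bar> \<le> E (\<lambda>n. \<bar>vote_prob P n 0 - f_poly n (pmf P 0)\<bar>)"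
    by (rule integral_abs_bound)
  also have "\<dots> \<le> E (\<lambda>n. real n * ?y)"
    using vote_prob_0_f_poly[OF assms]
    by (intro E_mono integrable_abs Bochner_Integration.integrable_diff integrable_vote_prob int
        integrable_mult_left integrable_real) auto
  also have "\<dots> = mean * ?y" by (simp add: mean_def)
  finally show ?thesis .
qed

section \<open>Orbits of the root law\<close>

text \<open>By induction 1 and 2 share the whole mass: an odd number of votes for 1 and 2 alone
  cannot tie, which is \<open>F 0 = 0\<close>, and the exchange with ratio 0 gives no mass to other
  opinions.\<close>

lemma root_law_half_half:
  assumes p: "set_pmf p \<subseteq> {0..k}" "k \<ge> 2" "pmf p 1 = 1 / 2" "pmf p 2 = 1 / 2" and "i \<le> k"
  shows "pmf (root_law q p m) i = two_opinion_vector 0 i"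
proof -
  have vec: "pmf P i = two_opinion_vector 0 i"
    if P: "set_pmf P \<subseteq> {0..k}" "pmf P 1 = 1 / 2" "pmf P 2 = 1 / 2" "i \<le> k" for P :: "nat pmf" and i
  proof -
    have "pmf P 0 + (\<Sum>j\<in>{3..k}. pmf P j) = 0"
      using sum_pmf_eq_split_01_2[OF P(1) p(2)] P by simp
    moreover have "0 \<le> (\<Sum>j\<in>{3..k}. pmf P j)" by (simp add: sum_nonneg)
    ultimately have "pmf P 0 = 0" "(\<Sum>j\<in>{3..k}. pmf P j) = 0"
      using pmf_nonneg[of P 0] by linarith+
    then have "pmf P 0 = 0" "\<And>j. j \<in> {3..k} \<Longrightarrow> pmf P j = 0"
      by (auto simp: sum_nonneg_eq_0_iff)
    moreover have "i = 0 \<or> i = 1 \<or> i = 2 \<or> i \<in> {3..k}" using P by auto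
    ultimately show ?thesis using P by (auto simp: two_opinion_vector_def)
  qed
  have "pmf (root_law q p m) 1 = 1 / 2 \<and> pmf (root_law q p m) 2 = 1 / 2"
  proof (induction m)
    case (Suc m)
    let ?P = "root_law q p m"
    have supp: "set_pmf (root_law q p m) \<subseteq> {0..k}" for m using p(1) by (rule set_pmf_root_law)
    have P: "pmf ?P j = two_opinion_vector 0 j" if "j \<le> k" for j
      using Suc that by (intro vec supp) auto
    have P12: "pmf ?P 1 = pmf ?P 2" using Suc by simp
    have eq12: "pmf (root_law q p (Suc m)) 1 = pmf (root_law q p (Suc m)) 2"
      unfolding pmf_root_law_Suc using p(2) P12 by (intro E_vote_prob_eq[OF supp]) auto
    have "F 0 = 0"
    proof -
      have "f_poly n 0 = 0" if "n \<in> set_pmf q" for n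
      proof -
        have "n - 2 * j > 0" if "2 * j \<le> n" for j
          using odd_support[OF \<open>n \<in> set_pmf q\<close>] that by (elim oddE) presburger
        then show ?thesis unfolding f_poly_def by (intro sum.neutral) auto
      qed
      then have "F 0 = E (\<lambda>n. 0)"
        unfolding F_def by (intro integral_cong_AE) (auto simp: AE_measure_pmf_iff)
      then show ?thesis by simp
    qed
    have zero: "pmf (root_law q p (Suc m)) 0 = 0"
    proof -
      have "1 - pmf ?P 0 - 2 * pmf ?P 1 = 0"
        using P[of 0] Suc by (simp add: two_opinion_vector_def)
      then show ?thesis
        using E_vote_prob_0_F[OF P12] P[of 0] \<open>F 0 = 0\<close> unfolding pmf_root_law_Suc
        by (simp add: two_opinion_vector_def)
    qed
    have "pmf (root_law q p (Suc m)) j = 0" if j: "j \<in> {3..k}" for j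
    proof -
      have "pmf (root_law q p (Suc m)) j \<le> 0"
        unfolding pmf_root_law_Suc
        using E_vote_prob_swap_le[OF supp, of 1 j m 0] j P[of j] by (auto simp: two_opinion_vector_def)
      then show ?thesis by (simp add: order_antisym)
    qed
    then have "(\<Sum>j\<in>{3..k}. pmf (root_law q p (Suc m)) j) = 0" by (intro sum.neutral) auto
    with sum_pmf_eq_split_01_2[OF supp p(2), of "Suc m"] zero eq12 show ?case by auto
  qed (use p in \<open>simp add: root_law_0\<close>)
  then show ?thesis using assms by (intro vec set_pmf_root_law) auto
qed

lemma root_law_tendsto:
  assumes \<alpha>: "0 < \<alpha>" "\<alpha> < 1" "\<And>t. 0 < t \<Longrightarrow> t < \<alpha> \<Longrightarrow> t < F t" "\<And>t. \<alpha> < t \<Longrightarrow> t < 1 \<Longrightarrow> F t < t"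
    and p: "set_pmf p \<subseteq> {0..k}" "k \<ge> 2" "pmf p 1 = pmf p 2" "0 < pmf p 1" "pmf p 1 < 1 / 2"
    and less: "\<And>j. j \<in> {3..k} \<Longrightarrow> pmf p j < pmf p 1"
    and "i \<le> k"
  shows "(\<lambda>m. pmf (root_law q p m) i) \<longlonglongrightarrow> two_opinion_vector \<alpha> i"
proof -
  define P where "P = root_law q p"
  define a where "a = (\<lambda>m i. pmf (P m) i)"
  have supp: "set_pmf (P m) \<subseteq> {0..k}" for m unfolding P_def using p(1) by (rule set_pmf_root_law)
  have a_Suc: "a (Suc m) i = E (\<lambda>n. vote_prob (P m) n i)" for m i
    by (simp add: a_def P_def pmf_root_law_Suc)
  have a0: "a 0 i = pmf p i" for i by (simp add: a_def P_def root_law_0)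
  have a_bounds: "0 \<le> a m i" "a m i \<le> 1" for m i by (simp_all add: a_def pmf_le_1)
  have a12: "a m 1 = a m 2" for m
  proof (induction m)
    case (Suc m)
    then show ?case using p(2) unfolding a_Suc by (intro E_vote_prob_eq[OF supp]) (auto simp: a_def)
  qed (use p(3) in \<open>simp add: a0\<close>)
  have total: "a m 0 + 2 * a m 1 + (\<Sum>j\<in>{3..k}. a m j) = 1" for m
    using sum_pmf_eq_split_01_2[OF supp p(2), of m] a12[of m] by (simp add: a_def)
  have a1_ge_gen: "gen (a m 1) \<le> a (Suc m) 1" for m
    using E_vote_prob_ge_gen[of 1 "P m"] unfolding a_Suc by (simp add: a_def)
  have a1_ge_single: "3 * a m 1 * (1 - mean * (1 - a m 0)) \<le> a (Suc m) 1" for m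
    using E_vote_prob_ge_single[of 1 "P m"] unfolding a_Suc by (simp add: a_def)
  have pos: "a m 1 > 0" for m
  proof (induction m)
    case (Suc m)
    then have "0 < gen (a m 1)" using a_bounds by (intro gen_pos)
    also have "\<dots> \<le> a (Suc m) 1" by (rule a1_ge_gen)
    finally show ?case .
  qed (use p(4) in \<open>simp add: a0\<close>)
  define r where "r = (\<lambda>m j. a m j / a m 1)"
  have r_nonneg: "0 \<le> r m j" for m j using a_bounds pos[of m] by (simp add: r_def)
  have r_Suc: "r (Suc m) j \<le> r m j * (1 - (1 - r m j) * gen (a m 1))" if j: "j \<in> {3..k}" and le: "r m j \<le> 1" for m j
  proof -
    have "a (Suc m) j \<le> r m j * a (Suc m) 1 - r m j * (1 - r m j) * gen (a m 1)"
    proof -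
      have "a m j = r m j * a m 1" using pos[of m] by (simp add: r_def)
      then have "pmf (P m) j = r m j * pmf (P m) 1" by (simp only: a_def)
      from E_vote_prob_swap_le[OF supp _ _ _ this] show ?thesis
        using j le r_nonneg[of m j] by (simp add: a_Suc) (simp add: a_def)
    qed
    \<comment> \<open>The correction shrinks when multiplied by \<open>a (Suc m) 1 \<le> 1\<close>,
      and this common factor can then be divided out.\<close>
    also have "\<dots> \<le> r m j * a (Suc m) 1 - (r m j * (1 - r m j) * gen (a m 1)) * a (Suc m) 1"
    proof -
      have "0 \<le> r m j * (1 - r m j) * gen (a m 1)"
        using le r_nonneg[of m j] gen_pos[OF pos[of m] a_bounds(2)] by simp
      then show ?thesis using a_bounds(2)[of "Suc m" 1] by (simp add: mult_left_le)
    qed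
    also have "\<dots> = r m j * (1 - (1 - r m j) * gen (a m 1)) * a (Suc m) 1"
      by (simp add: algebra_simps)
    finally show ?thesis using pos[of "Suc m"] by (simp add: r_def field_simps)
  qed
  have r0: "r 0 j < 1" if "j \<in> {3..k}" for j
    using less[OF that] p by (simp add: r_def a0)
  \<comment> \<open>By \<open>r_Suc\<close> a ratio does not increase while it is at most 1, which
    the induction maintains from \<open>r 0 j < 1\<close>.\<close>
  have r_le: "r m j \<le> r 0 j" if j: "j \<in> {3..k}" for m j
  proof (induction m)
    case (Suc m)
    then have le: "r m j \<le> 1" using r0[OF j] by linarith
    have "r (Suc m) j \<le> r m j * (1 - (1 - r m j) * gen (a m 1))" by (rule r_Suc[OF j le])
    also have "\<dots> \<le> r m j"
      using le gen_pos[OF pos[of m] a_bounds(2)] r_nonneg[of m j] by (intro mult_left_le) auto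
    finally show ?case using Suc by linarith
  qed simp
  have a_le: "a m j \<le> a m 1" if j: "j \<in> {3..k}" for m j
  proof -
    have "r m j \<le> 1" using r_le[OF j, of m] r0[OF j] by linarith
    then show ?thesis using pos[of m] by (simp add: r_def)
  qed

  obtain \<delta> where \<delta>: "\<delta> > 0" "\<And>m. \<delta> \<le> a m 1"
  proof
    \<comment> \<open>The decided mass is at most \<open>real k * a m 1\<close>. As
      \<open>real k * \<eta> * mean = 2 / 3\<close>, for \<open>a m 1 \<le> \<eta>\<close> the
      factor \<open>3 * (1 - mean * (1 - a m 0))\<close> is at least 1 and \<open>a m 1\<close> does
      not decrease; above \<open>\<eta>\<close>, unanimity gives at least
      \<open>gen \<eta>\<close>.\<close>
    define \<eta> where "\<eta> = 2 / (3 * real k * mean)"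
    have \<eta>: "\<eta> > 0" "\<eta> \<le> 1" using p(2) mean_ge_3 mult_mono[of 1 "real k" 3 mean]
      by (auto simp: \<eta>_def field_simps)
    define \<delta> where "\<delta> = min (a 0 1) (gen \<eta>)"
    show "\<delta> > 0" using pos[of 0] gen_pos[OF \<eta>] by (simp add: \<delta>_def)
    show "\<delta> \<le> a m 1" for m
    proof (induction m)
      case (Suc m)
      show ?case
      proof (cases "a m 1 \<le> \<eta>")
        case True
        have "(\<Sum>j\<in>{3..k}. a m j) \<le> (\<Sum>j\<in>{3..k}. a m 1)" by (rule sum_mono) (rule a_le)
        also have "\<dots> = (real k - 2) * a m 1" using p(2) by (simp add: of_nat_diff)
        finally have "1 - a m 0 \<le> real k * a m 1" using total[of m] by (simp add: algebra_simps)
        also have "\<dots> \<le> real k * \<eta>" using True by (intro mult_left_mono) auto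
        finally have "mean * (1 - a m 0) \<le> mean * (real k * \<eta>)" using mean_ge_3 by (intro mult_left_mono) auto
        also have "\<dots> = 2 / 3" using p(2) mean_ge_3 by (simp add: \<eta>_def)
        finally have "1 / 3 \<le> 1 - mean * (1 - a m 0)" by simp
        then have "3 * a m 1 * (1 / 3) \<le> 3 * a m 1 * (1 - mean * (1 - a m 0))"
          using a_bounds by (intro mult_left_mono) auto
        also have "\<dots> \<le> a (Suc m) 1" by (rule a1_ge_single)
        finally show ?thesis using Suc by simp
      next
        case False
        then have "gen \<eta> \<le> gen (a m 1)" using \<eta> a_bounds by (intro gen_mono) auto
        also have "\<dots> \<le> a (Suc m) 1" by (rule a1_ge_gen)
        finally show ?thesis by (simp add: \<delta>_def)
      qed
    qed (simp add: \<delta>_def)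
  qed
  have \<delta>_le: "2 * \<delta> \<le> 1"
    using \<delta>(2)[of 0] p a0 by simp

  have r_lim: "(\<lambda>m. r m j) \<longlonglongrightarrow> 0" if j: "j \<in> {3..k}" for j
  proof -
    \<comment> \<open>The contraction factor at the largest ratio \<open>r 0 j\<close> and the lower
      bound \<open>\<delta>\<close> of \<open>a m 1\<close>.\<close>
    define \<kappa> where "\<kappa> = 1 - (1 - r 0 j) * gen \<delta>"
    have g: "0 < gen \<delta>" "gen \<delta> \<le> 1"
    proof -
      show "0 < gen \<delta>" using \<delta> \<delta>_le by (intro gen_pos) auto
      have "gen \<delta> \<le> gen 1" using \<delta> \<delta>_le by (intro gen_mono) auto
      then show "gen \<delta> \<le> 1" by (simp add: gen_def)
    qed
    have \<kappa>: "0 \<le> \<kappa>" "\<kappa> < 1"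
      using g r0[OF j] r_nonneg[of 0 j] mult_mono[of "1 - r 0 j" 1 "gen \<delta>" 1] by (auto simp: \<kappa>_def)
    have "r m j \<le> \<kappa> ^ m" for m
    proof (induction m)
      case (Suc m)
      have le: "r m j \<le> 1" using r_le[OF j, of m] r0[OF j] by linarith
      have "gen \<delta> \<le> gen (a m 1)" using \<delta> a_bounds by (intro gen_mono) auto
      then have "(1 - r 0 j) * gen \<delta> \<le> (1 - r m j) * gen (a m 1)"
        using r_le[OF j, of m] r0[OF j] g by (intro mult_mono) auto
      then have "r m j * (1 - (1 - r m j) * gen (a m 1)) \<le> r m j * \<kappa>"
        using r_nonneg[of m j] by (intro mult_left_mono) (auto simp: \<kappa>_def)
      also have "\<dots> \<le> \<kappa> ^ m * \<kappa>" using Suc \<kappa> by (intro mult_right_mono) auto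
      finally show ?case using r_Suc[OF j le] by (simp add: mult.commute[of \<kappa>])
    qed (use r0[OF j] in simp)
    then show ?thesis
      using \<kappa> r_nonneg by (intro tendsto_sandwich[OF _ _ tendsto_const LIMSEQ_power_zero[of \<kappa>]]) auto
  qed
  have a_lim: "(\<lambda>m. a m j) \<longlonglongrightarrow> 0" if j: "j \<in> {3..k}" for j
  proof (rule tendsto_sandwich[OF _ _ tendsto_const r_lim[OF j]])
    have "a m j \<le> r m j" for m
      using pos[of m] a_bounds(2)[of m 1] a_bounds(1)[of m j] by (simp add: r_def field_simps mult_left_le)
    then show "eventually (\<lambda>m. a m j \<le> r m j) sequentially" by simp
  qed (simp add: a_bounds)
  have sum_lim: "(\<lambda>m. \<Sum>j\<in>{3..k}. a m j) \<longlonglongrightarrow> 0"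
    using tendsto_sum[of "{3..k}" "\<lambda>j m. a m j" "\<lambda>_. 0"] a_lim by simp

  \<comment> \<open>The mass outside \<open>{1, 2}\<close> is followed instead of
    \<open>a m 0\<close>, which may vanish at \<open>m = 0\<close>.\<close>
  define s where "s = (\<lambda>m. 1 - 2 * a m 1)"
  have s_bounds: "a m 0 \<le> s m" "s m \<le> 1 - 2 * \<delta>" for m
    using total[of m] \<delta>(2)[of m] sum_nonneg[of "{3..k}" "a m"] a_bounds by (auto simp: s_def)
  have a0_ge: "3 / 2 * s m * (1 - mean * s m) \<le> a (Suc m) 0" "3 / 2 * s m * gen (1 - s m) \<le> a (Suc m) 0" for m
    using E_vote_prob_0_ge[OF supp p(2), of m] a12[of m] unfolding a_Suc s_def by (simp_all add: a_def)
  have s_nonneg: "0 \<le> s m" for m using a_bounds(1) s_bounds(1) by (rule order_trans)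
  have gen_s: "gen (2 * \<delta>) \<le> gen (1 - s m)" "0 < gen (2 * \<delta>)" for m
    using \<delta> \<delta>_le s_bounds[of m] s_nonneg[of m]
    by (auto intro!: gen_mono gen_pos)
  obtain \<sigma> where \<sigma>: "\<sigma> > 0" "\<And>m. \<sigma> \<le> s m"
  proof
    \<comment> \<open>The dichotomy used for \<open>\<delta>\<close> again: for
      \<open>s m \<le> \<eta>\<close> the factor \<open>3 / 2 * (1 - mean * s m)\<close> is at least
      1, and for larger \<open>s m\<close> the second bound of \<open>a0_ge\<close> applies. Both
      bound \<open>a (Suc m) 0\<close>, hence \<open>s (Suc m)\<close>, from below.\<close>
    define \<eta> where "\<eta> = 1 / (3 * mean)"
    have \<eta>: "\<eta> > 0" using mean_ge_3 by (simp add: \<eta>_def)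
    define \<sigma> where "\<sigma> = min (s 0) (3 / 2 * \<eta> * gen (2 * \<delta>))"
    show "\<sigma> > 0" using p \<eta> gen_s by (simp add: \<sigma>_def s_def a0)
    show "\<sigma> \<le> s m" for m
    proof (induction m)
      case (Suc m)
      show ?case
      proof (cases "s m \<le> \<eta>")
        case True
        then have "mean * s m \<le> mean * \<eta>" using mean_ge_3 by (intro mult_left_mono) auto
        also have "\<dots> = 1 / 3" using mean_ge_3 by (simp add: \<eta>_def)
        finally have "3 / 2 * s m * (2 / 3) \<le> 3 / 2 * s m * (1 - mean * s m)"
          using s_nonneg[of m] by (intro mult_left_mono) auto
        with a0_ge(1)[of m] s_bounds(1)[of "Suc m"] Suc show ?thesis by simp
      next
        case False
        then have "3 / 2 * \<eta> * gen (2 * \<delta>) \<le> 3 / 2 * s m * gen (1 - s m)"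
          using gen_s(1)[of m] gen_s(2) \<eta> s_nonneg[of m] by (intro mult_mono) auto
        with a0_ge(2)[of m] s_bounds(1)[of "Suc m"] show ?thesis by (simp add: \<sigma>_def)
      qed
    qed (simp add: \<sigma>_def)
  qed

  \<comment> \<open>Shifted by one generation, since the positive lower bound holds from generation
    1 on.\<close>
  define u where "u = (\<lambda>m. a (Suc m) 0)"
  have "u \<longlonglongrightarrow> \<alpha>"
  proof (rule perturbed_iteration_tendsto[OF \<alpha>])
    show "3 / 2 * \<sigma> * gen (2 * \<delta>) \<le> u m" for m
    proof -
      have "3 / 2 * \<sigma> * gen (2 * \<delta>) \<le> 3 / 2 * s m * gen (1 - s m)"
        using gen_s(1)[of m] gen_s(2) \<sigma>(1) \<sigma>(2)[of m] by (intro mult_mono) auto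
      with a0_ge(2)[of m] show ?thesis by (simp add: u_def)
    qed
    show "u m \<le> 1 - 2 * \<delta>" for m using s_bounds[of "Suc m"] by (simp add: u_def)
    show "0 < 3 / 2 * \<sigma> * gen (2 * \<delta>)" using \<sigma> gen_s by simp
    show "1 - 2 * \<delta> < 1" using \<delta> by simp
    \<comment> \<open>The perturbation is controlled by the mass of the opinions from 3 on, which
      tends to 0.\<close>
    have bound: "\<bar>u (Suc m) - F (u m)\<bar> \<le> mean * (\<Sum>j\<in>{3..k}. a (Suc m) j)" for m
    proof -
      have "\<bar>u (Suc m) - F (u m)\<bar> \<le> mean * (1 - a (Suc m) 0 - 2 * a (Suc m) 1)"
        unfolding u_def a_Suc[of "Suc m"]
        using E_vote_prob_0_F[OF a12[of "Suc m", unfolded a_def]] by (simp only: a_def)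
      moreover have "1 - a (Suc m) 0 - 2 * a (Suc m) 1 = (\<Sum>j\<in>{3..k}. a (Suc m) j)"
        using total[of "Suc m"] by linarith
      ultimately show ?thesis by simp
    qed
    have "(\<lambda>m. mean * (\<Sum>j\<in>{3..k}. a (Suc m) j)) \<longlonglongrightarrow> mean * 0"
      by (intro tendsto_intros LIMSEQ_Suc sum_lim)
    then have "(\<lambda>m. mean * (\<Sum>j\<in>{3..k}. a (Suc m) j)) \<longlonglongrightarrow> 0" by simp
    with always_eventually[OF allI] show "(\<lambda>m. u (Suc m) - F (u m)) \<longlonglongrightarrow> 0"
      by (rule Lim_null_comparison) (simp add: bound)
  qed
  then have lim0: "(\<lambda>m. a m 0) \<longlonglongrightarrow> \<alpha>" unfolding u_def by (rule LIMSEQ_imp_Suc)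
  \<comment> \<open>The total mass and the equality of \<open>a m 1\<close> and \<open>a m 2\<close>
    determine the two remaining limits.\<close>
  have "(\<lambda>m. (1 - a m 0 - (\<Sum>j\<in>{3..k}. a m j)) / 2) \<longlonglongrightarrow> (1 - \<alpha> - 0) / 2"
    by (intro tendsto_intros lim0 sum_lim) simp
  moreover have "(1 - a m 0 - (\<Sum>j\<in>{3..k}. a m j)) / 2 = a m 1" for m
    using total[of m] by (simp add: field_simps)
  ultimately have lim1: "(\<lambda>m. a m 1) \<longlonglongrightarrow> (1 - \<alpha>) / 2" by simp
  have lim2: "(\<lambda>m. a m 2) \<longlonglongrightarrow> (1 - \<alpha>) / 2" using lim1 a12 by simp
  have "i = 0 \<or> i = 1 \<or> i = 2 \<or> i \<in> {3..k}" using \<open>i \<le> k\<close> by auto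
  then have "(\<lambda>m. a m i) \<longlonglongrightarrow> two_opinion_vector \<alpha> i"
    using lim0 lim1 lim2 a_lim[of i] by (auto simp: two_opinion_vector_def)
  then show ?thesis by (simp add: a_def P_def)
qed

end

theorem corollary1p2:
  fixes q :: "nat pmf"
  assumes "pmf q 0 + pmf q 1 = 0"
    and "set_pmf q \<subseteq> {n. odd n}"
    and "summable (\<lambda>n. (real n)\<^sup>2 * pmf q n)"
  shows "\<exists>\<alpha>::real.
      \<alpha> \<in> {0<..<1} \<and> f_map q \<alpha> = \<alpha> \<and> (\<forall>t\<in>{0<..<1}. f_map q t = t \<longrightarrow> t = \<alpha>) \<and>
      (\<forall>k\<ge>2. \<forall>p\<in>prob_vectors k.
         (pmf p 1 = pmf p 2 \<and> (3 \<le> k \<longrightarrow> pmf p 2 > pmf p 3) \<and>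
          (\<forall>j. 3 \<le> j \<and> j < k \<longrightarrow> pmf p j \<ge> pmf p (j + 1)) \<and> pmf p 1 < 1 / 2 \<longrightarrow>
            (\<forall>i\<le>k. (\<lambda>m. pmf (root_law q p m) i) \<longlonglongrightarrow> two_opinion_vector \<alpha> i)) \<and>
         (pmf p 1 = 1 / 2 \<and> pmf p 2 = 1 / 2 \<longrightarrow>
            (\<forall>m. \<forall>i\<le>k. pmf (root_law q p m) i = two_opinion_vector 0 i)))"
proof -
  interpret offspring_law q
  proof
    show odd: "odd n" if "n \<in> set_pmf q" for n using assms(2) that by auto
    have "pmf q 1 = 0" using assms(1) by (simp add: add_nonneg_eq_0_iff)
    then show "n \<ge> 3" if "n \<in> set_pmf q" for n
      using odd[OF that] that by (cases "n = 1") (auto simp: pmf_eq_0_set_pmf elim!: oddE)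
    have "summable (\<lambda>n. pmf q n * real n)"
    proof (rule summable_comparison_test'[OF assms(3)])
      fix n :: nat
      have "real n \<le> (real n)\<^sup>2" by (cases "n = 0") (auto simp: power2_eq_square)
      then have "pmf q n * real n \<le> pmf q n * (real n)\<^sup>2" by (intro mult_left_mono) auto
      then show "norm (pmf q n * real n) \<le> (real n)\<^sup>2 * pmf q n" by (simp add: mult.commute)
    qed
    then have "integrable (count_space UNIV) (\<lambda>n. pmf q n * real n)"
      by (simp add: integrable_count_space_nat_iff)
    then show "integrable (measure_pmf q) real"
      unfolding measure_pmf_eq_density by (subst integrable_density) auto
  qed
  \<comment> \<open>This \<open>\<alpha>\<close> depends on \<open>q\<close> alone, so it is fixed
    before \<open>k\<close> and \<open>p\<close>; the strict inequalities on its two sides give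
    uniqueness.\<close>
  obtain \<alpha> where \<alpha>: "0 < \<alpha>" "\<alpha> < 1" "F \<alpha> = \<alpha>"
    "\<And>t. 0 < t \<Longrightarrow> t < \<alpha> \<Longrightarrow> t < F t" "\<And>t. \<alpha> < t \<Longrightarrow> t < 1 \<Longrightarrow> F t < t"
    using fixed_point by blast
  show ?thesis
  proof (intro exI[of _ \<alpha>] conjI ballI allI impI)
    show "\<alpha> \<in> {0<..<1}" using \<alpha> by simp
    show "f_map q \<alpha> = \<alpha>" using \<alpha> by (simp add: f_map_eq_F)
    show "t = \<alpha>" if "t \<in> {0<..<1}" "f_map q t = t" for t
      using that \<alpha>(4)[of t] \<alpha>(5)[of t] by (cases t \<alpha> rule: linorder_cases) (auto simp: f_map_eq_F)
  next
    fix k i :: nat and p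
    assume k: "2 \<le> k" and p: "p \<in> prob_vectors k" and i: "i \<le> k"
      and *: "pmf p 1 = pmf p 2 \<and> (3 \<le> k \<longrightarrow> pmf p 2 > pmf p 3) \<and>
        (\<forall>j. 3 \<le> j \<and> j < k \<longrightarrow> pmf p j \<ge> pmf p (j + 1)) \<and> pmf p 1 < 1 / 2"
    have supp: "set_pmf p \<subseteq> {0..k}" and p0: "pmf p 0 < 1" using p by (auto simp: prob_vectors_def)
    have less: "pmf p j < pmf p 1" if j: "j \<in> {3..k}" for j
    proof -
      have "j \<ge> 3" "j \<le> k" using j by auto
      then have "pmf p j \<le> pmf p 3"
      proof (induction j rule: nat_induct_at_least)
        case (Suc j)
        then have "pmf p (j + 1) \<le> pmf p j" using * by auto
        with Suc show ?case by simp
      qed simp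
      with * j show ?thesis by auto
    qed
    \<comment> \<open>If opinion 1 had probability 0, no other opinion would have mass and
      \<open>pmf p 0\<close> would be 1, which \<open>prob_vectors\<close> excludes.\<close>
    have "0 < pmf p 1"
    proof (rule ccontr)
      assume "\<not> 0 < pmf p 1"
      then have "pmf p 1 = 0" by (simp add: not_less order_antisym)
      moreover have "(\<Sum>j\<in>{3..k}. pmf p j) \<le> 0"
        using less calculation by (intro sum_nonpos) (metis less_eq_real_def)
      ultimately show False using sum_pmf_eq_split_01_2[OF supp k] * p0 by simp
    qed
    then show "(\<lambda>m. pmf (root_law q p m) i) \<longlonglongrightarrow> two_opinion_vector \<alpha> i"
      using \<alpha> supp k * less i by (intro root_law_tendsto) auto
  next
    fix k i m :: nat and p
    assume "2 \<le> k" "p \<in> prob_vectors k" "i \<le> k" "pmf p 1 = 1 / 2 \<and> pmf p 2 = 1 / 2"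
    then show "pmf (root_law q p m) i = two_opinion_vector 0 i"
      by (intro root_law_half_half) (auto simp: prob_vectors_def)
  qed
qed

end
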